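(* Let $\boldsymbol\rho_0\in(\mathrm L^1\cap\mathrm L^\infty)(\mathbb R^2;\mathbb R_+^N)$ and assume that the hypotheses (H0), (H1) and (H2) stated in the context hold, with $M>0$ the constant of (H1). Then there exists a constant $C\ge0$, depending only on $\boldsymbol\rho_0,\boldsymbol\eta,\boldsymbol\nu,\{f^k\}_{k=1}^N$ and $\{g^k\}_{k=1}^N$ (in particular not on the discretization parameters), such that the following holds. Let $\theta\in[0,1]$ be the parameter of the minmod slope limiter, let $\alpha,\beta\in\bigl(0,\tfrac{1}{3(1+\theta)}\bigr)$ be the coefficients of the numerical fluxes, put $\bar\alpha:=2\alpha$, $\bar\beta:=2\beta$, $\bar\lambda_x:=2\Delta t/\Delta x$, $\bar\lambda_y:=2\Delta t/\Delta y$, and suppose that the CFL conditions $$\bar\lambda_x\le\frac{\min\{1,\;4-6\bar\alpha(1+\theta),\;6\bar\alpha\}}{6(1+\theta)\|\partial_\rho f^k\|+1},\qquad \bar\lambda_y\le\frac{\min\{1,\;4-6\bar\beta(1+\theta),\;6\bar\beta\}}{6(1+\theta)\|\partial_\rho g^k\|+1}$$ hold for all $k\in\{1,\dots,N\}$, together with the mesh-size restriction $\Delta x,\Delta y\le\frac1{3M}$. Then the approximate solution $\boldsymbol\rho_\Delta$ produced by the second-order scheme defined in the context satisfies $$\|\boldsymbol\rho_\Delta(t)\|\le\|\boldsymbol\rho_\Delta(0)\|\,e^{Ct}\qquad\text{for any } t\in\mathbb R_+,$$ where $\|\boldsymbol\rho_\Delta(t)\|=\max_{1\le k\le N}\|\rho^k_\Delta(t,\cdot,\cdot)\|_{\mathrm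 L^\infty(\mathbb R^2)}$.
   Context: **Notation.** $\mathbb R_+=[0,\infty)$, $\mathbb R_+^N=[0,\infty)^N$; $\|\cdot\|$ denotes the $\mathrm L^\infty$ (sup) norm (over the whole domain of definition for functions; the maximum norm for vectors in $\mathbb R^m$). **Problem.** Fix integers $N,m\ge1$. For $k=1,\dots,N$ consider the non-local system in two space dimensions $$\partial_t\rho^k+\partial_x f^k(t,x,y,\rho^k,\boldsymbol\eta*\boldsymbol\rho)+\partial_y g^k(t,x,y,\rho^k,\boldsymbol\nu*\boldsymbol\rho)=0,\qquad \boldsymbol\rho(0,\cdot)=\boldsymbol\rho_0=(\rho_0^1,\dots,\rho_0^N),$$ where $\boldsymbol\eta=(\eta^{q,k})$ and $\boldsymbol\nu=(\nu^{q,k})$ are $m\times N$ matrices of functions $\mathbb R^2\to\mathbb R$ and $(\boldsymbol\eta*\boldsymbol\rho)_q=\sum_{k=1}^N\eta^{q,k}*\rho^k$ (convolution in space), similarly for $\boldsymbol\nu$. **Hypotheses.** (H0) For each $k$: $f^k,g^k\in \mathrm C^2(\mathbb R_+\times\mathbb R^2\times\mathbb R\times\mathbb R^m;\mathbb R)$; $\partial_\rho f^k,\partial_\rho g^k\in \mathrm L^\infty(\mathbb R_+\times\mathbb R^2\times\mathbb R\times\mathbb R^m;\mathbb R)$; and $f^k(t,x,y,0,\boldsymbol A)=g^k(t,x,y,0,\boldsymbol B)=0$ for all $t\in\mathbb R_+$, $(x,y)\in\mathbb R^2$, $\boldsymbol A,\boldsymbol B\in\mathbb R^m$. (H1) There is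 $M>0$ such that for all $k$ and all arguments $(t,x,y,\rho,\boldsymbol A)$, resp. $(t,x,y,\rho,\boldsymbol B)$: $|\partial_xf^k|\le M|\rho|$, $\|\nabla_{\boldsymbol A}f^k\|\le M|\rho|$, $|\partial_yg^k|\le M|\rho|$, $\|\nabla_{\boldsymbol B}g^k\|\le M|\rho|$. (This $M$ is fixed and regarded as part of the data of $\{f^k\},\{g^k\}$.) (H2) $\boldsymbol\eta,\boldsymbol\nu\in(\mathrm C^2\cap \mathrm W^{1,\infty})(\mathbb R^2;\mathbb R^{m\times N})$. **Mesh.** For $\Delta x,\Delta y,\Delta t>0$: $x_i=i\Delta x$, $x_{i+\frac12}=(i+\frac12)\Delta x$, $y_j=j\Delta y$, $y_{j+\frac12}=(j+\frac12)\Delta y$ ($i,j\in\mathbb Z$), $t^n=n\Delta t$ ($n=0,1,2,\dots$), $\lambda_x=\Delta t/\Delta x$, $\lambda_y=\Delta t/\Delta y$. Initial cell averages: $\rho^{k,0}_{i,j}=\frac1{\Delta x\Delta y}\int_{x_{i-1/2}}^{x_{i+1/2}}\int_{y_{j-1/2}}^{y_{j+1/2}}\rho_0^k(x,y)\,dy\,dx$. **Reconstruction.** $\mathrm{minmod}(a_1,\dots,a_p)=\mathrm{sgn}(a_1)\min_l|a_l|$ if $\mathrm{sgn}(a_1)=\dots=\mathrm{sgn}(a_p)$, and $0$ otherwise. For a grid function $(\rho_{i,j})$ and a parameter $\theta\in[0,1]$ set $\sigma^x_{i,j}=2\theta\,\mathrm{minmod}\bigl(\rho_{i,j}-\rho_{i-1,j},\tfrac12(\rho_{i+1,j}-\rho_{i-1,j}),\rho_{i+1,j}-\rho_{i,j}\bigr)$,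 $\sigma^y_{i,j}=2\theta\,\mathrm{minmod}\bigl(\rho_{i,j}-\rho_{i,j-1},\tfrac12(\rho_{i,j+1}-\rho_{i,j-1}),\rho_{i,j+1}-\rho_{i,j}\bigr)$, and face values $\rho^-_{i+\frac12,j}=\rho_{i,j}+\frac12\sigma^x_{i,j}$, $\rho^+_{i-\frac12,j}=\rho_{i,j}-\frac12\sigma^x_{i,j}$, $\rho^-_{i,j+\frac12}=\rho_{i,j}+\frac12\sigma^y_{i,j}$, $\rho^+_{i,j-\frac12}=\rho_{i,j}-\frac12\sigma^y_{i,j}$. **Numerical fluxes.** Given grid functions $\boldsymbol\rho=(\rho^k_{i,j})$ and a time $\tau$, define the discrete convolutions, for $q=1,\dots,m$, $A^q_{i+\frac12,j}=\Delta x\Delta y\sum_{k=1}^N\sum_{l,p\in\mathbb Z}\eta^{q,k}(x_{i+\frac12}-x_l,y_j-y_p)\rho^k_{l,p}$, $\;B^q_{i,j+\frac12}=\Delta x\Delta y\sum_{k=1}^N\sum_{l,p\in\mathbb Z}\nu^{q,k}(x_i-x_l,y_{j+\frac12}-y_p)\rho^k_{l,p}$, $f^k_{i+\frac12,j}(u)=f^k(\tau,x_{i+\frac12},y_j,u,\boldsymbol A_{i+\frac12,j})$, $g^k_{i,j+\frac12}(u)=g^k(\tau,x_i,y_{j+\frac12},u,\boldsymbol B_{i,j+\frac12})$, and with fixed coefficients $\alpha,\beta$ $$F^k_{i+\frac12,j}(u,v)=\tfrac12\bigl(f^k_{i+\frac12,j}(u)+f^k_{i+\frac12,j}(v)\bigr)-\tfrac{\alpha(v-u)}{2\lambda_x},\quad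 G^k_{i,j+\frac12}(u,v)=\tfrac12\bigl(g^k_{i,j+\frac12}(u)+g^k_{i,j+\frac12}(v)\bigr)-\tfrac{\beta(v-u)}{2\lambda_y}.$$ **Euler step.** Given $\boldsymbol\rho$ and $\tau$, with face values and fluxes computed from them, let $\mathcal E_\tau(\boldsymbol\rho)$ be the grid function with components $$\rho^k_{i,j}-\lambda_x\bigl[F^k_{i+\frac12,j}(\rho^{k,-}_{i+\frac12,j},\rho^{k,+}_{i+\frac12,j})-F^k_{i-\frac12,j}(\rho^{k,-}_{i-\frac12,j},\rho^{k,+}_{i-\frac12,j})\bigr]-\lambda_y\bigl[G^k_{i,j+\frac12}(\rho^{k,-}_{i,j+\frac12},\rho^{k,+}_{i,j+\frac12})-G^k_{i,j-\frac12}(\rho^{k,-}_{i,j-\frac12},\rho^{k,+}_{i,j-\frac12})\bigr].$$ **Second-order scheme.** $\boldsymbol\rho^{(1)}=\mathcal E_{t^n}(\boldsymbol\rho^n)$, $\boldsymbol\rho^{(2)}=\mathcal E_{t^{n+1}}(\boldsymbol\rho^{(1)})$, $\boldsymbol\rho^{n+1}=\frac12(\boldsymbol\rho^n+\boldsymbol\rho^{(2)})$. The approximate solution is $\rho^k_\Delta(t,x,y)=\rho^{k,n}_{i,j}$ for $(t,x,y)\in[t^n,t^{n+1})\times[x_{i-\frac12},x_{i+\frac12})\times[y_{j-\frac12},y_{j+\frac12})$. *)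

theory Defs
  imports "HOL-Probability.Essential_Supremum"
begin

section \<open>Function spaces and norms\<close>

text \<open>The \<open>L\<^sup>\<infinity>\<close> norm on a set \<open>S\<close>; its value is \<open>\<infinity>\<close> for functions that are not Lebesgue
  measurable or not essentially bounded, so finiteness expresses membership in \<open>L\<^sup>\<infinity>(S)\<close>.\<close>

definition Linf_norm :: "'a::euclidean_space set \<Rightarrow> ('a \<Rightarrow> real) \<Rightarrow> ereal" where
  "Linf_norm S u = esssup (lebesgue_on S) (\<lambda>z. ereal \<bar>u z\<bar>)"

text \<open>\<open>C\<^sup>2\<close> regularity on \<open>S\<close>, with derivatives taken relative to \<open>S\<close> (one-sided at the boundary).
  Only used for convex sets with nonempty interior, where these derivatives are unique.\<close>

definition C2_on :: "'a::real_normed_vector set \<Rightarrow> ('a \<Rightarrow> real) \<Rightarrow> bool" where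
  "C2_on S u \<longleftrightarrow>
     (\<exists>(u' :: 'a \<Rightarrow> ('a \<Rightarrow>\<^sub>L real)) (u'' :: 'a \<Rightarrow> ('a \<Rightarrow>\<^sub>L ('a \<Rightarrow>\<^sub>L real))).
        (\<forall>z\<in>S. (u has_derivative blinfun_apply (u' z)) (at z within S)) \<and>
        (\<forall>z\<in>S. (u' has_derivative blinfun_apply (u'' z)) (at z within S)) \<and>
        continuous_on S u'')"

text \<open>For a \<open>C\<^sup>2\<close> function the weak partial derivatives in the definition of \<open>W\<^sup>1\<^sup>,\<^sup>\<infinity>\<close> are the
  classical ones.\<close>

definition C2_W1inf :: "(real \<times> real \<Rightarrow> real) \<Rightarrow> bool" where
  "C2_W1inf u \<longleftrightarrow> C2_on UNIV u \<and>
     Linf_norm UNIV u < \<infinity> \<and>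
     Linf_norm UNIV (\<lambda>(x, y). deriv (\<lambda>s. u (s, y)) x) < \<infinity> \<and>
     Linf_norm UNIV (\<lambda>(x, y). deriv (\<lambda>s. u (x, s)) y) < \<infinity>"


section \<open>Hypotheses on the data\<close>

text \<open>Arguments of a flux function are ordered as \<open>(t, x, y, \<rho>, A)\<close>. Equations are indexed by the
  finite type \<open>'n\<close> (so \<open>N = CARD('n)\<close>), non-local terms by \<open>'m\<close>.\<close>

type_synonym 'm args = "real \<times> real \<times> real \<times> real \<times> (real ^ 'm)"

definition flux_dom :: "('m::finite) args set" where
  "flux_dom = {0..} \<times> UNIV"

definition D_x :: "(('m::finite) args \<Rightarrow> real) \<Rightarrow> 'm args \<Rightarrow> real" where
  "D_x h = (\<lambda>(t, x, y, r, A). deriv (\<lambda>s. h (t, s, y, r, A)) x)"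

definition D_y :: "(('m::finite) args \<Rightarrow> real) \<Rightarrow> 'm args \<Rightarrow> real" where
  "D_y h = (\<lambda>(t, x, y, r, A). deriv (\<lambda>s. h (t, x, s, r, A)) y)"

definition D_rho :: "(('m::finite) args \<Rightarrow> real) \<Rightarrow> 'm args \<Rightarrow> real" where
  "D_rho h = (\<lambda>(t, x, y, r, A). deriv (\<lambda>s. h (t, x, y, s, A)) r)"

definition grad_A :: "(('m::finite) args \<Rightarrow> real) \<Rightarrow> 'm args \<Rightarrow> real ^ 'm" where
  "grad_A h = (\<lambda>(t, x, y, r, A).
     \<chi> q. deriv (\<lambda>s. h (t, x, y, r, \<chi> p. if p = q then s else A $ p)) (A $ q))"

definition flux_regular :: "('n \<Rightarrow> ('m::finite) args \<Rightarrow> real) \<Rightarrow> bool" where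
  "flux_regular f \<longleftrightarrow>
     (\<forall>k. C2_on flux_dom (f k) \<and>
          Linf_norm flux_dom (D_rho (f k)) < \<infinity> \<and>
          (\<forall>t x y A. 0 \<le> t \<longrightarrow> f k (t, x, y, 0, A) = 0))"

definition flux_growth ::
  "real \<Rightarrow> ('n \<Rightarrow> ('m::finite) args \<Rightarrow> real) \<Rightarrow> ('n \<Rightarrow> 'm args \<Rightarrow> real) \<Rightarrow> bool" where
  "flux_growth M f g \<longleftrightarrow>
     (\<forall>k t x y r A. 0 \<le> t \<longrightarrow>
        \<bar>D_x (f k) (t, x, y, r, A)\<bar> \<le> M * \<bar>r\<bar> \<and>
        infnorm (grad_A (f k) (t, x, y, r, A)) \<le> M * \<bar>r\<bar> \<and>
        \<bar>D_y (g k) (t, x, y, r, A)\<bar> \<le> M * \<bar>r\<bar> \<and>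
        infnorm (grad_A (g k) (t, x, y, r, A)) \<le> M * \<bar>r\<bar>)"

definition kernel_regular :: "('m \<Rightarrow> 'n \<Rightarrow> real \<times> real \<Rightarrow> real) \<Rightarrow> bool" where
  "kernel_regular \<eta> \<longleftrightarrow> (\<forall>q k. C2_W1inf (\<eta> q k))"

definition initial_datum :: "('n \<Rightarrow> real \<times> real \<Rightarrow> real) \<Rightarrow> bool" where
  "initial_datum \<rho>\<^sub>0 \<longleftrightarrow>
     (\<forall>k. integrable lebesgue (\<rho>\<^sub>0 k) \<and> Linf_norm UNIV (\<rho>\<^sub>0 k) < \<infinity> \<and>
          (AE z in lebesgue. 0 \<le> \<rho>\<^sub>0 k z))"


section \<open>Reconstruction\<close>

text \<open>Quantities living on the vertical face \<open>(i+1/2, j)\<close> or the horizontal face \<open>(i, j+1/2)\<close>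
  are indexed by the integers \<open>i\<close>, \<open>j\<close>. Hence \<open>recon_x_plus \<theta> r i j\<close>, the value
  \<open>\<rho>\<^sup>+\<close> at \<open>(i+1/2, j)\<close>, is computed from the cell \<open>(i+1, j)\<close>.\<close>

definition minmod :: "real list \<Rightarrow> real" where
  "minmod as = (if \<forall>a\<in>set as. sgn a = sgn (hd as)
                then sgn (hd as) * Min (abs ` set as) else 0)"

definition slope_x :: "real \<Rightarrow> (int \<Rightarrow> int \<Rightarrow> real) \<Rightarrow> int \<Rightarrow> int \<Rightarrow> real" where
  "slope_x \<theta> r i j =
     2 * \<theta> * minmod [r i j - r (i - 1) j, (r (i + 1) j - r (i - 1) j) / 2, r (i + 1) j - r i j]"

definition slope_y :: "real \<Rightarrow> (int \<Rightarrow> int \<Rightarrow> real) \<Rightarrow> int \<Rightarrow> int \<Rightarrow> real" where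
  "slope_y \<theta> r i j =
     2 * \<theta> * minmod [r i j - r i (j - 1), (r i (j + 1) - r i (j - 1)) / 2, r i (j + 1) - r i j]"

definition recon_x_minus :: "real \<Rightarrow> (int \<Rightarrow> int \<Rightarrow> real) \<Rightarrow> int \<Rightarrow> int \<Rightarrow> real" where
  "recon_x_minus \<theta> r i j = r i j + slope_x \<theta> r i j / 2"

definition recon_x_plus :: "real \<Rightarrow> (int \<Rightarrow> int \<Rightarrow> real) \<Rightarrow> int \<Rightarrow> int \<Rightarrow> real" where
  "recon_x_plus \<theta> r i j = r (i + 1) j - slope_x \<theta> r (i + 1) j / 2"

definition recon_y_minus :: "real \<Rightarrow> (int \<Rightarrow> int \<Rightarrow> real) \<Rightarrow> int \<Rightarrow> int \<Rightarrow> real" where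
  "recon_y_minus \<theta> r i j = r i j + slope_y \<theta> r i j / 2"

definition recon_y_plus :: "real \<Rightarrow> (int \<Rightarrow> int \<Rightarrow> real) \<Rightarrow> int \<Rightarrow> int \<Rightarrow> real" where
  "recon_y_plus \<theta> r i j = r i (j + 1) - slope_y \<theta> r i (j + 1) / 2"


section \<open>Numerical fluxes\<close>

definition conv_x :: "('m::finite \<Rightarrow> 'n::finite \<Rightarrow> real \<times> real \<Rightarrow> real) \<Rightarrow> real \<Rightarrow> real \<Rightarrow>
    ('n \<Rightarrow> int \<Rightarrow> int \<Rightarrow> real) \<Rightarrow> int \<Rightarrow> int \<Rightarrow> real ^ 'm" where
  "conv_x \<eta> dx dy r i j = (\<chi> q. dx * dy * (\<Sum>k\<in>UNIV. \<Sum>\<^sub>\<infinity>(l::int, p::int)\<in>UNIV.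
     \<eta> q k ((of_int i + 1/2) * dx - of_int l * dx, of_int j * dy - of_int p * dy) * r k l p))"

definition conv_y :: "('m::finite \<Rightarrow> 'n::finite \<Rightarrow> real \<times> real \<Rightarrow> real) \<Rightarrow> real \<Rightarrow> real \<Rightarrow>
    ('n \<Rightarrow> int \<Rightarrow> int \<Rightarrow> real) \<Rightarrow> int \<Rightarrow> int \<Rightarrow> real ^ 'm" where
  "conv_y \<nu> dx dy r i j = (\<chi> q. dx * dy * (\<Sum>k\<in>UNIV. \<Sum>\<^sub>\<infinity>(l::int, p::int)\<in>UNIV.
     \<nu> q k (of_int i * dx - of_int l * dx, (of_int j + 1/2) * dy - of_int p * dy) * r k l p))"

definition num_flux_x :: "('n::finite \<Rightarrow> ('m::finite) args \<Rightarrow> real) \<Rightarrow>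
    ('m \<Rightarrow> 'n \<Rightarrow> real \<times> real \<Rightarrow> real) \<Rightarrow> real \<Rightarrow> real \<Rightarrow> real \<Rightarrow> real \<Rightarrow> real \<Rightarrow>
    ('n \<Rightarrow> int \<Rightarrow> int \<Rightarrow> real) \<Rightarrow> 'n \<Rightarrow> int \<Rightarrow> int \<Rightarrow> real \<Rightarrow> real \<Rightarrow> real" where
  "num_flux_x f \<eta> \<alpha> dx dy dt \<tau> r k i j u v =
     (let h = (\<lambda>w. f k (\<tau>, (of_int i + 1/2) * dx, of_int j * dy, w, conv_x \<eta> dx dy r i j))
      in (h u + h v) / 2 - \<alpha> * (v - u) / (2 * (dt / dx)))"

definition num_flux_y :: "('n::finite \<Rightarrow> ('m::finite) args \<Rightarrow> real) \<Rightarrow>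
    ('m \<Rightarrow> 'n \<Rightarrow> real \<times> real \<Rightarrow> real) \<Rightarrow> real \<Rightarrow> real \<Rightarrow> real \<Rightarrow> real \<Rightarrow> real \<Rightarrow>
    ('n \<Rightarrow> int \<Rightarrow> int \<Rightarrow> real) \<Rightarrow> 'n \<Rightarrow> int \<Rightarrow> int \<Rightarrow> real \<Rightarrow> real \<Rightarrow> real" where
  "num_flux_y g \<nu> \<beta> dx dy dt \<tau> r k i j u v =
     (let h = (\<lambda>w. g k (\<tau>, of_int i * dx, (of_int j + 1/2) * dy, w, conv_y \<nu> dx dy r i j))
      in (h u + h v) / 2 - \<beta> * (v - u) / (2 * (dt / dy)))"


section \<open>The second-order scheme\<close>

definition euler_step :: "('n::finite \<Rightarrow> ('m::finite) args \<Rightarrow> real) \<Rightarrow> ('n \<Rightarrow> 'm args \<Rightarrow> real) \<Rightarrow>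
    ('m \<Rightarrow> 'n \<Rightarrow> real \<times> real \<Rightarrow> real) \<Rightarrow> ('m \<Rightarrow> 'n \<Rightarrow> real \<times> real \<Rightarrow> real) \<Rightarrow>
    real \<Rightarrow> real \<Rightarrow> real \<Rightarrow> real \<Rightarrow> real \<Rightarrow> real \<Rightarrow> real \<Rightarrow>
    ('n \<Rightarrow> int \<Rightarrow> int \<Rightarrow> real) \<Rightarrow> 'n \<Rightarrow> int \<Rightarrow> int \<Rightarrow> real" where
  "euler_step f g \<eta> \<nu> \<theta> \<alpha> \<beta> dx dy dt \<tau> r k i j =
     (let F = (\<lambda>i. num_flux_x f \<eta> \<alpha> dx dy dt \<tau> r k i j
                     (recon_x_minus \<theta> (r k) i j) (recon_x_plus \<theta> (r k) i j));
          G = (\<lambda>j. num_flux_y g \<nu> \<beta> dx dy dt \<tau> r k i j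
                     (recon_y_minus \<theta> (r k) i j) (recon_y_plus \<theta> (r k) i j))
      in r k i j - dt / dx * (F i - F (i - 1)) - dt / dy * (G j - G (j - 1)))"

definition cell :: "real \<Rightarrow> real \<Rightarrow> int \<Rightarrow> int \<Rightarrow> (real \<times> real) set" where
  "cell dx dy i j = {(of_int i - 1/2) * dx ..< (of_int i + 1/2) * dx} \<times>
                    {(of_int j - 1/2) * dy ..< (of_int j + 1/2) * dy}"

definition cell_averages :: "real \<Rightarrow> real \<Rightarrow> ('n \<Rightarrow> real \<times> real \<Rightarrow> real) \<Rightarrow>
    'n \<Rightarrow> int \<Rightarrow> int \<Rightarrow> real" where
  "cell_averages dx dy \<rho>\<^sub>0 k i j = 1 / (dx * dy) * (LINT z:cell dx dy i j|lebesgue. \<rho>\<^sub>0 k z)"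

primrec scheme :: "('n::finite \<Rightarrow> ('m::finite) args \<Rightarrow> real) \<Rightarrow> ('n \<Rightarrow> 'm args \<Rightarrow> real) \<Rightarrow>
    ('m \<Rightarrow> 'n \<Rightarrow> real \<times> real \<Rightarrow> real) \<Rightarrow> ('m \<Rightarrow> 'n \<Rightarrow> real \<times> real \<Rightarrow> real) \<Rightarrow>
    real \<Rightarrow> real \<Rightarrow> real \<Rightarrow> real \<Rightarrow> real \<Rightarrow> real \<Rightarrow>
    ('n \<Rightarrow> real \<times> real \<Rightarrow> real) \<Rightarrow> nat \<Rightarrow> 'n \<Rightarrow> int \<Rightarrow> int \<Rightarrow> real" where
  "scheme f g \<eta> \<nu> \<theta> \<alpha> \<beta> dx dy dt \<rho>\<^sub>0 0 = cell_averages dx dy \<rho>\<^sub>0"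
| "scheme f g \<eta> \<nu> \<theta> \<alpha> \<beta> dx dy dt \<rho>\<^sub>0 (Suc n) =
     (let r = scheme f g \<eta> \<nu> \<theta> \<alpha> \<beta> dx dy dt \<rho>\<^sub>0 n;
          r1 = euler_step f g \<eta> \<nu> \<theta> \<alpha> \<beta> dx dy dt (real n * dt) r;
          r2 = euler_step f g \<eta> \<nu> \<theta> \<alpha> \<beta> dx dy dt (real (Suc n) * dt) r1
      in (\<lambda>k i j. (r k i j + r2 k i j) / 2))"

definition approx_sol :: "('n::finite \<Rightarrow> ('m::finite) args \<Rightarrow> real) \<Rightarrow> ('n \<Rightarrow> 'm args \<Rightarrow> real) \<Rightarrow>
    ('m \<Rightarrow> 'n \<Rightarrow> real \<times> real \<Rightarrow> real) \<Rightarrow> ('m \<Rightarrow> 'n \<Rightarrow> real \<times> real \<Rightarrow> real) \<Rightarrow>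
    real \<Rightarrow> real \<Rightarrow> real \<Rightarrow> real \<Rightarrow> real \<Rightarrow> real \<Rightarrow>
    ('n \<Rightarrow> real \<times> real \<Rightarrow> real) \<Rightarrow> 'n \<Rightarrow> real \<Rightarrow> real \<times> real \<Rightarrow> real" where
  "approx_sol f g \<eta> \<nu> \<theta> \<alpha> \<beta> dx dy dt \<rho>\<^sub>0 k t = (\<lambda>(x, y).
     scheme f g \<eta> \<nu> \<theta> \<alpha> \<beta> dx dy dt \<rho>\<^sub>0 (nat \<lfloor>t / dt\<rfloor>) k \<lfloor>x / dx + 1/2\<rfloor> \<lfloor>y / dy + 1/2\<rfloor>)"

text \<open>The floor functions select the space-time cell containing the given point.\<close>

lemma approx_sol_eq:
  fixes n :: nat
  assumes "dx > 0" "dy > 0" "dt > 0"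
    and "t \<in> {real n * dt ..< real (Suc n) * dt}" and "(x, y) \<in> cell dx dy i j"
  shows "approx_sol f g \<eta> \<nu> \<theta> \<alpha> \<beta> dx dy dt \<rho>\<^sub>0 k t (x, y) =
         scheme f g \<eta> \<nu> \<theta> \<alpha> \<beta> dx dy dt \<rho>\<^sub>0 n k i j"
proof -
  have "\<lfloor>t / dt\<rfloor> = int n"
    using assms by (intro floor_unique) (auto simp: field_simps)
  moreover have "\<lfloor>x / dx + 1/2\<rfloor> = i" "\<lfloor>y / dy + 1/2\<rfloor> = j"
    using assms by (auto simp: cell_def field_simps intro!: floor_unique)
  ultimately show ?thesis
    by (simp add: approx_sol_def)
qed

definition sup_norm :: "('n::finite \<Rightarrow> real \<times> real \<Rightarrow> real) \<Rightarrow> ereal" where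
  "sup_norm u = (MAX k. Linf_norm UNIV (u k))"

end

theory Submission
  imports Defs
begin

text \<open>An Euler step is the mean of two one-dimensional steps, one along each axis, with doubled ratio
  \<open>2\<Delta>t/\<Delta>x\<close> resp. \<open>2\<Delta>t/\<Delta>y\<close>. The CFL condition makes these steps positivity preserving, and the
  conservative form preserves the mass of each component, so the discrete \<open>L\<^sup>1\<close> norm stays below that
  of the initial datum. Hence the discrete convolutions are Lipschitz in space with a constant
  depending only on the data. If the flux is frozen at one face of a cell, the new value is a convex
  combination of old ones; by (H1) the variation of the flux between the two faces of the cell costs
  at most a factor \<open>1 + c\<Delta>t\<close>. The Heun average then grows by at most
  \<open>(1 + (1 + c\<Delta>t)\<^sup>2)/2 \<le> exp (2c\<Delta>t)\<close>, so \<open>C = 2c\<close> works.\<close>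

section \<open>Pointwise consequences of the hypotheses\<close>

text \<open>No maximum principle is available, because the flux function changes from face to face,
  both explicitly with the position and through the convolutions. The latter are sums over the whole
  grid; their variation is controlled by the L1 norm, not by the sup norm. Conservation only fixes
  the signed sum, which is that norm just for non-negative values, so positivity has to accompany
  the estimates through every stage. The factor \<open>\<bar>r\<bar>\<close> in (H1) makes the cost
  of the variation proportional to the current sup norm, hence linear growth and an exponential. The
  constant is \<open>c = 2 * M * (1 + CARD('m) * B * W)\<close>, where \<open>B\<close> bounds the
  kernels and their Lipschitz constants and \<open>W\<close> is the total mass of the initial datum.

  The CFL condition enters as \<open>\<kappa> * L \<le> \<alpha>\<close>, which gives the right
  signs, and \<open>(1 + \<theta>) * (\<alpha> + \<kappa> * L) \<le> 1 / 3\<close>, which keeps the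
  weights small. The data are bounded by essential suprema and through \<open>deriv\<close>, so
  these bounds are first turned into Lipschitz estimates valid at every point.\<close>

lemma AE_le_imp_le_on:
  fixes u :: "'a::euclidean_space \<Rightarrow> real"
  assumes "convex S" "closed S" "interior S \<noteq> {}" "continuous_on S u"
    and ae: "AE z in lebesgue_on S. u z \<le> c" and "z \<in> S"
  shows "u z \<le> c"
proof (rule ccontr)
  assume "\<not> u z \<le> c"
  obtain U where "open U" and U: "U \<inter> S = S \<inter> u -` {c<..}"
    using continuous_openin_preimage_gen[OF assms(4) open_greaterThan[of c]]
    unfolding openin_open by blast
  have "z \<in> U" using U assms(6) \<open>\<not> u z \<le> c\<close> by auto
  \<comment> \<open>This admits boundary points: the open set \<open>U\<close> around
    \<open>z\<close> still meets the interior, so the bound would fail on a nonempty open set, which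
    is not null.\<close>
  moreover have "z \<in> closure (interior S)"
    using convex_closure_interior[OF assms(1,3)] assms(6) closure_subset by blast
  ultimately have ne: "U \<inter> interior S \<noteq> {}"
    using \<open>open U\<close> open_Int_closure_eq_empty by blast
  have "AE z in lebesgue. z \<in> S \<longrightarrow> u z \<le> c"
    using ae assms(2) by (subst (asm) AE_restrict_space_iff) auto
  then obtain N where "N \<in> null_sets lebesgue" "{z. \<not> (z \<in> S \<longrightarrow> u z \<le> c)} \<subseteq> N"
    by (auto simp: eventually_ae_filter)
  moreover have "U \<inter> interior S \<subseteq> {z. \<not> (z \<in> S \<longrightarrow> u z \<le> c)}"
    using U interior_subset[of S] by (auto simp: set_eq_iff not_le)
  ultimately have "negligible (U \<inter> interior S)"
    by (meson negligible_iff_null_sets negligible_subset)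
  then show False
    using open_not_negligible[OF _ ne] \<open>open U\<close> by blast
qed

lemma AE_le_Linf_norm:
  assumes "Linf_norm S u < \<infinity>"
  shows "AE z in lebesgue_on S. \<bar>u z\<bar> \<le> real_of_ereal (Linf_norm S u)"
proof -
  have "AE z in lebesgue_on S. ereal \<bar>u z\<bar> \<le> Linf_norm S u"
    unfolding Linf_norm_def by (rule esssup_AE)
  then show ?thesis
    by eventually_elim (use assms in \<open>cases "Linf_norm S u"; auto\<close>)
qed

text \<open>Makes the essential bounds of (H0) and (H2) available at every point, as the mean value
  estimates below require.\<close>

lemma abs_le_Linf_norm:
  fixes u :: "'a::euclidean_space \<Rightarrow> real"
  assumes "convex S" "closed S" "interior S \<noteq> {}" "continuous_on S u"
    and "Linf_norm S u < \<infinity>" "z \<in> S"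
  shows "\<bar>u z\<bar> \<le> real_of_ereal (Linf_norm S u)"
  using AE_le_imp_le_on[of S "\<lambda>z. \<bar>u z\<bar>"] AE_le_Linf_norm[OF assms(5)] assms
  by (auto intro: continuous_intros)

lemma C2_on_imp_C1:
  assumes "C2_on S u"
  obtains u' where "\<And>z. z \<in> S \<Longrightarrow> (u has_derivative blinfun_apply (u' z)) (at z within S)"
    and "continuous_on S u'"
proof -
  from assms obtain u' u'' where
    "\<forall>z\<in>S. (u has_derivative blinfun_apply (u' z)) (at z within S)"
    "\<forall>z\<in>S. (u' has_derivative blinfun_apply (u'' z)) (at z within S)"
    unfolding C2_on_def by blast
  moreover from this(2) have "continuous_on S u'" by (intro has_derivative_continuous_on) blast
  ultimately show thesis by (intro that[of u']) auto
qed

text \<open>The curve stays in \<open>S\<close>, so a derivative relative to \<open>S\<close>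
  becomes two-sided in the parameter. This covers \<open>t = 0\<close>, since the curves used for
  the fluxes keep \<open>t\<close> fixed.\<close>

lemma has_real_derivative_along:
  assumes "(u has_derivative u') (at (p s) within S)" "(p has_vector_derivative v) (at s)"
    and "range p \<subseteq> S"
  shows "((\<lambda>s. u (p s)) has_real_derivative u' v) (at s)"
proof -
  interpret bounded_linear u' using assms(1) by (rule has_derivative_bounded_linear)
  have "(u has_derivative u') (at (p s) within range p)"
    using assms(1,3) by (rule has_derivative_subset)
  moreover have "(p has_derivative (\<lambda>h. h *\<^sub>R v)) (at s)"
    using assms(2) by (simp add: has_vector_derivative_def)
  ultimately have "(u \<circ> p has_derivative u' \<circ> (\<lambda>h. h *\<^sub>R v)) (at s)"
    by (intro diff_chain_within) auto
  then show ?thesis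
    by (simp add: has_field_derivative_def o_def scaleR mult_commute_abs)
qed

lemma abs_diff_le_deriv_bound:
  fixes \<phi> :: "real \<Rightarrow> real"
  assumes "\<And>s. (\<phi> has_real_derivative \<phi>' s) (at s)" "\<And>s. \<bar>\<phi>' s\<bar> \<le> K"
  shows "\<bar>\<phi> a - \<phi> b\<bar> \<le> K * \<bar>a - b\<bar>"
  using field_differentiable_bound[of UNIV \<phi> \<phi>' K a b] assms by auto

section \<open>Lipschitz estimates for fluxes and kernels\<close>

lemma flux_dom_iff: "(t, z) \<in> flux_dom \<longleftrightarrow> 0 \<le> t"
  by (simp add: flux_dom_def)

lemma flux_dom_props:
  "convex (flux_dom :: ('m::finite) args set)" "closed (flux_dom :: ('m::finite) args set)"
  "interior (flux_dom :: ('m::finite) args set) \<noteq> {}"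
  by (auto simp: flux_dom_def interior_Times convex_Times closed_Times)

text \<open>\<open>deriv\<close> is a choice operator, so bounds on it are informative only once the
  partial derivatives are known to exist; here they are read off from the total derivative.\<close>

lemma flux_partial_derivatives:
  fixes h :: "('m::finite) args \<Rightarrow> real"
  assumes h': "\<And>z. z \<in> flux_dom \<Longrightarrow> (h has_derivative blinfun_apply (h' z)) (at z within flux_dom)"
    and "0 \<le> t"
  shows "D_x h (t, x, y, r, A) = h' (t, x, y, r, A) (0, 1, 0, 0, 0)"
    and "D_y h (t, x, y, r, A) = h' (t, x, y, r, A) (0, 0, 1, 0, 0)"
    and "D_rho h (t, x, y, r, A) = h' (t, x, y, r, A) (0, 0, 0, 1, 0)"
    and "grad_A h (t, x, y, r, A) $ q = h' (t, x, y, r, A) (0, 0, 0, 0, axis q 1)"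
proof -
  have *: "((\<lambda>s. h (p s)) has_real_derivative h' (p s) v) (at s)"
    if "(p has_vector_derivative v) (at s)" "\<And>s. fst (p s) = t" for p v s
  proof -
    have "p s \<in> flux_dom" for s using that(2)[of s] \<open>0 \<le> t\<close> by (simp add: flux_dom_def mem_Times_iff)
    then show ?thesis using h' that(1) by (intro has_real_derivative_along[where S = flux_dom]) auto
  qed
  show "D_x h (t, x, y, r, A) = h' (t, x, y, r, A) (0, 1, 0, 0, 0)"
    unfolding D_x_def
    by (simp, rule DERIV_imp_deriv, rule *[where p = "\<lambda>s. (t, s, y, r, A)"])
      (auto intro!: derivative_eq_intros simp: has_vector_derivative_def zero_prod_def)
  show "D_y h (t, x, y, r, A) = h' (t, x, y, r, A) (0, 0, 1, 0, 0)"
    unfolding D_y_def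
    by (simp, rule DERIV_imp_deriv, rule *[where p = "\<lambda>s. (t, x, s, r, A)"])
      (auto intro!: derivative_eq_intros simp: has_vector_derivative_def zero_prod_def)
  show "D_rho h (t, x, y, r, A) = h' (t, x, y, r, A) (0, 0, 0, 1, 0)"
    unfolding D_rho_def
    by (simp, rule DERIV_imp_deriv, rule *[where p = "\<lambda>s. (t, x, y, s, A)"])
      (auto intro!: derivative_eq_intros simp: has_vector_derivative_def zero_prod_def)
  \<comment> \<open>Replacing one component of \<open>A\<close> is written as an affine curve, to
    which the chain rule applies.\<close>
  have eq: "(\<chi> p. if p = q then s else A $ p) = A + (s - A $ q) *\<^sub>R axis q 1" for s
    by (auto simp: vec_eq_iff axis_def)
  have "((\<lambda>s. h (t, x, y, r, A + (s - A $ q) *\<^sub>R axis q 1)) has_real_derivative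
      h' (t, x, y, r, A + (A $ q - A $ q) *\<^sub>R axis q 1) (0, 0, 0, 0, axis q 1)) (at (A $ q))"
    by (rule *[where p = "\<lambda>s. (t, x, y, r, A + (s - A $ q) *\<^sub>R axis q 1)"])
      (auto intro!: derivative_eq_intros simp: has_vector_derivative_def zero_prod_def)
  then show "grad_A h (t, x, y, r, A) $ q = h' (t, x, y, r, A) (0, 0, 0, 0, axis q 1)"
    unfolding grad_A_def by (simp add: eq DERIV_imp_deriv)
qed

lemma flux_lipschitz_density:
  fixes h :: "('m::finite) args \<Rightarrow> real"
  assumes "C2_on flux_dom h" "Linf_norm flux_dom (D_rho h) < \<infinity>" "0 \<le> t"
  shows "\<bar>h (t, x, y, u, A) - h (t, x, y, v, A)\<bar>
     \<le> real_of_ereal (Linf_norm flux_dom (D_rho h)) * \<bar>u - v\<bar>"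
proof -
  obtain h' where h': "\<And>z. z \<in> flux_dom \<Longrightarrow> (h has_derivative blinfun_apply (h' z)) (at z within flux_dom)"
    and "continuous_on flux_dom h'" using C2_on_imp_C1[OF assms(1)] by blast
  have D: "D_rho h z = h' z (0, 0, 0, 1, 0)" if "z \<in> flux_dom" for z
    using that by (cases z) (auto simp: flux_dom_iff flux_partial_derivatives(3)[OF h'])
  have "continuous_on flux_dom (D_rho h)"
    using \<open>continuous_on flux_dom h'\<close> by (subst continuous_on_cong[OF refl D]) (auto intro!: continuous_intros)
  then have bound: "\<bar>D_rho h z\<bar> \<le> real_of_ereal (Linf_norm flux_dom (D_rho h))" if "z \<in> flux_dom" for z
    using abs_le_Linf_norm[OF flux_dom_props] assms(2) that by blast
  show ?thesis
  proof (rule abs_diff_le_deriv_bound[where \<phi> = "\<lambda>s. h (t, x, y, s, A)"])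
    show "((\<lambda>s. h (t, x, y, s, A)) has_real_derivative h' (t, x, y, s, A) (0, 0, 0, 1, 0)) (at s)" for s
      using h'[of "(t, x, y, s, A)"] \<open>0 \<le> t\<close>
      by (intro has_real_derivative_along[where S = flux_dom])
        (auto intro!: derivative_eq_intros simp: has_vector_derivative_def zero_prod_def flux_dom_def)
    show "\<bar>h' (t, x, y, s, A) (0, 0, 0, 1, 0)\<bar> \<le> real_of_ereal (Linf_norm flux_dom (D_rho h))" for s
      using D[of "(t, x, y, s, A)"] bound[of "(t, x, y, s, A)"] \<open>0 \<le> t\<close> by (simp add: flux_dom_iff)
  qed
qed

text \<open>The weights \<open>a\<close>, \<open>b\<close> cover both families of fluxes: \<open>f\<close> only varies with \<open>x\<close> and \<open>g\<close> only
  with \<open>y\<close> between neighbouring faces.\<close>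

lemma flux_variation_position:
  fixes h :: "('m::finite) args \<Rightarrow> real"
  assumes "C2_on flux_dom h" "0 \<le> t"
    and bound: "\<And>x y A. \<bar>a * D_x h (t, x, y, r, A)\<bar> \<le> \<bar>a\<bar> * K \<and> \<bar>b * D_y h (t, x, y, r, A)\<bar> \<le> \<bar>b\<bar> * K
      \<and> infnorm (grad_A h (t, x, y, r, A)) \<le> K"
  shows "\<bar>h (t, x + a, y + b, r, A) - h (t, x, y, r, A')\<bar>
     \<le> K * (\<bar>a\<bar> + \<bar>b\<bar> + (\<Sum>q\<in>UNIV. \<bar>A $ q - A' $ q\<bar>))"
proof -
  obtain h' where h': "\<And>z. z \<in> flux_dom \<Longrightarrow> (h has_derivative blinfun_apply (h' z)) (at z within flux_dom)"
    using C2_on_imp_C1[OF assms(1)] by blast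
  define v where "v = A - A'"
  \<comment> \<open>The segment keeps the density \<open>r\<close> fixed, so the bound
    \<open>K\<close>, later \<open>M * \<bar>u\<bar>\<close>, holds all along it.\<close>
  define p where "p = (\<lambda>s. (t, x + s * a, y + s * b, r, A' + s *\<^sub>R v))"
  have "((\<lambda>s. h (p s)) has_real_derivative h' (p s) (0, a, b, 0, v)) (at s)" for s
    using h'[of "p s"] \<open>0 \<le> t\<close> unfolding p_def
    by (intro has_real_derivative_along[where S = flux_dom])
      (auto intro!: derivative_eq_intros simp: has_vector_derivative_def zero_prod_def flux_dom_def)
  moreover have "\<bar>h' (p s) (0, a, b, 0, v)\<bar> \<le> K * (\<bar>a\<bar> + \<bar>b\<bar> + (\<Sum>q\<in>UNIV. \<bar>v $ q\<bar>))" for s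
  proof -
    define z where "z = p s"
    obtain x' y' A'' where z: "z = (t, x', y', r, A'')" unfolding z_def p_def by blast
    have v: "v = (\<Sum>q\<in>UNIV. v $ q *\<^sub>R axis q 1)"
      by (auto simp: vec_eq_iff axis_def if_distrib sum.delta cong: if_cong)
    have sumv: "(0, 0, 0, 0, v) = (\<Sum>q\<in>UNIV. v $ q *\<^sub>R ((0, 0, 0, 0, axis q 1) :: 'm args))"
      by (subst v) (simp add: prod_eq_iff fst_sum snd_sum)
    have "((0, a, b, 0, v) :: 'm args) = a *\<^sub>R (0, 1, 0, 0, 0) + b *\<^sub>R (0, 0, 1, 0, 0) + (0, 0, 0, 0, v)" by simp
    then have "((0, a, b, 0, v) :: 'm args) = a *\<^sub>R (0, 1, 0, 0, 0) + b *\<^sub>R (0, 0, 1, 0, 0)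
        + (\<Sum>q\<in>UNIV. v $ q *\<^sub>R (0, 0, 0, 0, axis q 1))"
      unfolding sumv .
    then have "h' z (0, a, b, 0, v) = a * D_x h z + b * D_y h z + (\<Sum>q\<in>UNIV. v $ q * grad_A h z $ q)"
      by (simp only: blinfun.add_right blinfun.scaleR_right blinfun.sum_right z
        flux_partial_derivatives[OF h' \<open>0 \<le> t\<close>] real_scaleR_def)
    \<comment> \<open>The gradient is bounded in the maximum norm, whose dual is the sum of the
      absolute increments of \<open>A\<close>.\<close>
    moreover have "\<bar>\<Sum>q\<in>UNIV. v $ q * grad_A h z $ q\<bar> \<le> (\<Sum>q\<in>UNIV. \<bar>v $ q\<bar> * K)"
    proof (rule order_trans[OF sum_abs], rule sum_mono)
      fix q
      have "\<bar>grad_A h z $ q\<bar> \<le> K"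
        using component_le_infnorm_cart[of "grad_A h z" q] bound[of x' y' A''] z by auto
      then show "\<bar>v $ q * grad_A h z $ q\<bar> \<le> \<bar>v $ q\<bar> * K"
        by (simp add: abs_mult mult_left_mono)
    qed
    moreover have "\<bar>a * D_x h z\<bar> \<le> \<bar>a\<bar> * K" "\<bar>b * D_y h z\<bar> \<le> \<bar>b\<bar> * K" using bound z by auto
    ultimately show ?thesis
      unfolding z_def[symmetric] by (simp add: algebra_simps sum_distrib_left abs_le_iff)
  qed
  ultimately have "\<bar>h (p 1) - h (p 0)\<bar> \<le> (K * (\<bar>a\<bar> + \<bar>b\<bar> + (\<Sum>q\<in>UNIV. \<bar>v $ q\<bar>))) * \<bar>1 - 0\<bar>"
    by (rule abs_diff_le_deriv_bound)
  then show ?thesis by (simp add: p_def v_def)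
qed

text \<open>Neighbouring faces on a grid line differ in one coordinate, hence the Lipschitz bounds
  in each variable separately.\<close>

lemma kernel_bounded_lipschitz:
  assumes "C2_W1inf u"
  obtains B where "\<And>z. \<bar>u z\<bar> \<le> B" "\<And>x x' y. \<bar>u (x, y) - u (x', y)\<bar> \<le> B * \<bar>x - x'\<bar>"
    "\<And>x y y'. \<bar>u (x, y) - u (x, y')\<bar> \<le> B * \<bar>y - y'\<bar>"
proof -
  obtain u' where u': "\<And>z. (u has_derivative blinfun_apply (u' z)) (at z)"
    and cont: "continuous_on UNIV u'" using assms C2_on_imp_C1[of UNIV u] unfolding C2_W1inf_def by auto
  have dx: "((\<lambda>s. u (s, y)) has_real_derivative u' (x, y) (1, 0)) (at x)" for x y
    using u' by (intro has_real_derivative_along[where S = UNIV and p = "\<lambda>s. (s, y)"])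
      (auto intro!: derivative_eq_intros simp: has_vector_derivative_def zero_prod_def)
  have dy: "((\<lambda>s. u (x, s)) has_real_derivative u' (x, y) (0, 1)) (at y)" for x y
    using u' by (intro has_real_derivative_along[where S = UNIV and p = "\<lambda>s. (x, s)"])
      (auto intro!: derivative_eq_intros simp: has_vector_derivative_def zero_prod_def)
  have fin: "Linf_norm UNIV u < \<infinity>" "Linf_norm UNIV (\<lambda>z. u' z (1, 0)) < \<infinity>"
     "Linf_norm UNIV (\<lambda>z. u' z (0, 1)) < \<infinity>"
    using assms unfolding C2_W1inf_def by (simp_all add: DERIV_imp_deriv[OF dx] DERIV_imp_deriv[OF dy] case_prod_unfold)
  have "continuous_on UNIV u"
    using u' by (meson continuous_at_imp_continuous_on has_derivative_continuous)
  note bound = abs_le_Linf_norm[OF convex_UNIV closed_UNIV, simplified]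
  define B where "B = max (real_of_ereal (Linf_norm UNIV u))
    (max (real_of_ereal (Linf_norm UNIV (\<lambda>z. u' z (1, 0)))) (real_of_ereal (Linf_norm UNIV (\<lambda>z. u' z (0, 1)))))"
  have B: "\<bar>u z\<bar> \<le> B" "\<bar>u' z (1, 0)\<bar> \<le> B" "\<bar>u' z (0, 1)\<bar> \<le> B" for z
    using bound[OF \<open>continuous_on UNIV u\<close>, of z] bound[of "\<lambda>z. u' z (1, 0)" z]
      bound[of "\<lambda>z. u' z (0, 1)" z] fin cont
    unfolding B_def by (simp_all add: le_max_iff_disj continuous_intros)
  show thesis
    using B abs_diff_le_deriv_bound[OF dx B(2)] abs_diff_le_deriv_bound[OF dy B(3)] by (intro that) auto
qed

section \<open>The scheme along one grid line\<close>

text \<open>A nonzero minmod has the sign of each argument and at most its modulus. A factor in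
  \<open>{0..1}\<close> records both facts, for whichever argument is convenient.\<close>

lemma minmod_eq_mult:
  assumes "a \<in> set as"
  shows "\<exists>c\<in>{0..1}. minmod as = c * a"
proof (cases "\<forall>b\<in>set as. sgn b = sgn (hd as)")
  case True
  define \<mu> where "\<mu> = Min (abs ` set as)"
  have "0 \<le> \<mu>" "\<mu> \<le> \<bar>a\<bar>"
    using assms unfolding \<mu>_def by (auto intro!: Min.boundedI Min.coboundedI)
  moreover have "minmod as = sgn a * \<mu>" using True assms by (auto simp: minmod_def \<mu>_def)
  \<comment> \<open>For \<open>a = 0\<close> the witness is \<open>0\<close>, by division by zero,
    and \<open>minmod as\<close> vanishes too.\<close>
  ultimately show ?thesis
    by (intro bexI[of _ "\<mu> / \<bar>a\<bar>"]) (auto simp: sgn_if divide_simps)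
next
  case False
  then show ?thesis by (intro bexI[of _ 0]) (auto simp: minmod_def)
qed

text \<open>The factor 2 stays outside so that half a slope, the correction at a face, is
  \<open>c\<close> times a difference with \<open>c \<le> \<theta>\<close>.\<close>

lemma limited_slope:
  assumes "a \<in> set as" "\<theta> \<in> {0..1}"
  shows "\<exists>c\<in>{0..\<theta>}. 2 * \<theta> * minmod as = 2 * c * a"
proof -
  obtain c where "c \<in> {0..1}" "minmod as = c * a" using minmod_eq_mult[OF assms(1)] by blast
  then show ?thesis
    using assms(2) by (intro bexI[of _ "\<theta> * c"]) (auto simp: mult_left_le)
qed

lemma lipschitz_secant:
  fixes \<phi> :: "real \<Rightarrow> real"
  assumes "\<And>u v. \<bar>\<phi> u - \<phi> v\<bar> \<le> L * \<bar>u - v\<bar>"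
  obtains s where "\<bar>s\<bar> \<le> L" "\<phi> u - \<phi> v = s * (u - v)"
proof (cases "u = v")
  case True
  have "0 \<le> L" using assms[of 1 0] by simp
  then show thesis using True by (intro that[of 0]) auto
next
  case False
  then show thesis
    using assms[of u v] by (intro that[of "(\<phi> u - \<phi> v) / (u - v)"]) (auto simp: divide_simps)
qed

text \<open>\<open>h i\<close> is the flux function at the face \<open>i + 1/2\<close> and \<open>\<kappa>\<close> is \<open>\<Delta>t/\<Delta>x\<close>; steps along the line use \<open>2\<kappa>\<close>.\<close>

locale grid_line =
  fixes w s :: "int \<Rightarrow> real" and h :: "int \<Rightarrow> real \<Rightarrow> real" and \<theta> \<alpha> \<kappa> L :: real
  assumes slope_left: "\<And>i. \<exists>c\<in>{0..\<theta>}. s i = 2 * c * (w i - w (i - 1))"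
    and slope_right: "\<And>i. \<exists>c\<in>{0..\<theta>}. s i = 2 * c * (w (i + 1) - w i)"
    and h_zero: "\<And>i. h i 0 = 0"
    and h_lipschitz: "\<And>i u v. \<bar>h i u - h i v\<bar> \<le> L * \<bar>u - v\<bar>"
    and theta: "0 \<le> \<theta>" "\<theta> \<le> 1" and kappa_pos: "0 < \<kappa>"
    and viscosity: "\<kappa> * L \<le> \<alpha>" and cfl: "(1 + \<theta>) * (\<alpha> + \<kappa> * L) \<le> 1 / 3"
begin

text \<open>\<open>left i\<close> and \<open>right i\<close> are the two values at the face
  \<open>i + 1/2\<close>, taken from the cells \<open>i\<close> and \<open>i + 1\<close>. Cell
  \<open>i\<close> thus owns \<open>left i\<close> and \<open>right (i - 1)\<close>.\<close>

definition "left i = w i + s i / 2"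
definition "right i = w (i + 1) - s (i + 1) / 2"
definition "flux i = (h i (left i) + h i (right i)) / 2 - \<alpha> * (right i - left i) / (2 * \<kappa>)"
definition "step i = w i - 2 * \<kappa> * (flux i - flux (i - 1))"

lemma L_nonneg: "0 \<le> L"
  using h_lipschitz[of 0 1 0] by simp

lemma alpha_nonneg: "0 \<le> \<alpha>"
  using viscosity L_nonneg kappa_pos by (meson less_imp_le mult_nonneg_nonneg order_trans)

text \<open>As \<open>\<theta> \<le> 1\<close>, half a slope does not exceed the difference to the
  neighbour, so the reconstruction creates no new extrema.\<close>

lemma left_convex: "\<exists>c\<in>{0..1}. left i = (1 - c) * w i + c * w (i + 1)"
proof -
  obtain c where "c \<in> {0..\<theta>}" "s i = 2 * c * (w (i + 1) - w i)" using slope_right by blast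
  then show ?thesis using theta by (intro bexI[of _ c]) (auto simp: left_def algebra_simps)
qed

lemma right_convex: "\<exists>c\<in>{0..1}. right i = c * w i + (1 - c) * w (i + 1)"
proof -
  obtain c where "c \<in> {0..\<theta>}" "s (i + 1) = 2 * c * (w (i + 1) - w i)"
    using slope_left[of "i + 1"] by auto
  then show ?thesis using theta by (intro bexI[of _ c]) (auto simp: right_def algebra_simps)
qed

text \<open>Both slopes are measured against the same difference \<open>w i - w (i - 1)\<close>:
  that of cell \<open>i\<close> on its left, that of cell \<open>i - 1\<close> on its right. The
  factor \<open>1 + c - d\<close> lies between \<open>1 - \<theta>\<close> and
  \<open>1 + \<theta>\<close>, whence the \<open>1 + \<theta>\<close> in the CFL condition.\<close>

lemma left_increment: "\<exists>c\<in>{0..1 + \<theta>}. left i - left (i - 1) = c * (w i - w (i - 1))"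
proof -
  obtain c where "c \<in> {0..\<theta>}" "s i = 2 * c * (w i - w (i - 1))" using slope_left by blast
  moreover obtain d where "d \<in> {0..\<theta>}" "s (i - 1) = 2 * d * (w i - w (i - 1))"
    using slope_right[of "i - 1"] by auto
  ultimately show ?thesis
    using theta by (intro bexI[of _ "1 + c - d"]) (auto simp: left_def algebra_simps)
qed

lemma right_increment: "\<exists>c\<in>{0..1 + \<theta>}. right i - right (i - 1) = c * (w (i + 1) - w i)"
proof -
  obtain c where "c \<in> {0..\<theta>}" "s i = 2 * c * (w (i + 1) - w i)" using slope_right by blast
  moreover obtain d where "d \<in> {0..\<theta>}" "s (i + 1) = 2 * d * (w (i + 1) - w i)"
    using slope_left[of "i + 1"] by auto
  ultimately show ?thesis
    using theta by (intro bexI[of _ "1 + c - d"]) (auto simp: right_def algebra_simps)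
qed

lemma abs_face_le_sum: "\<bar>left i\<bar> \<le> \<bar>w i\<bar> + \<bar>w (i + 1)\<bar>" "\<bar>right i\<bar> \<le> \<bar>w i\<bar> + \<bar>w (i + 1)\<bar>"
proof -
  have *: "\<bar>(1 - c) * a + c * b\<bar> \<le> \<bar>a\<bar> + \<bar>b\<bar>" if "c \<in> {0..1}" for a b c :: real
  proof -
    have "\<bar>(1 - c) * a\<bar> \<le> \<bar>a\<bar>" "\<bar>c * b\<bar> \<le> \<bar>b\<bar>"
      using that by (auto simp: abs_mult intro!: mult_left_le_one_le)
    then show ?thesis by linarith
  qed
  show "\<bar>left i\<bar> \<le> \<bar>w i\<bar> + \<bar>w (i + 1)\<bar>" "\<bar>right i\<bar> \<le> \<bar>w i\<bar> + \<bar>w (i + 1)\<bar>"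
    using left_convex[of i] right_convex[of i] *[of _ "w i" "w (i + 1)"] *[of _ "w (i + 1)" "w i"]
    by (auto simp: add.commute)
qed

lemma abs_face_le:
  assumes "\<And>i. \<bar>w i\<bar> \<le> S"
  shows "\<bar>left i\<bar> \<le> S" "\<bar>right i\<bar> \<le> S"
proof -
  have *: "\<bar>(1 - c) * a + c * b\<bar> \<le> S" if "c \<in> {0..1}" "\<bar>a\<bar> \<le> S" "\<bar>b\<bar> \<le> S" for a b c :: real
  proof -
    have "\<bar>(1 - c) * a\<bar> \<le> (1 - c) * S" "\<bar>c * b\<bar> \<le> c * S"
      using that by (auto simp: abs_mult intro!: mult_left_mono)
    then show ?thesis by (simp add: algebra_simps)
  qed
  show "\<bar>left i\<bar> \<le> S" "\<bar>right i\<bar> \<le> S"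
    using left_convex[of i] right_convex[of i] *[of _ "w i" "w (i + 1)"] *[of _ "w (i + 1)" "w i"] assms
    by (auto simp: add.commute)
qed

text \<open>A crude bound by the two adjacent cells; its constant is the same at all faces, so
  summable cell values have summable fluxes.\<close>

lemma abs_flux_le: "\<bar>flux i\<bar> \<le> (L + \<alpha> / \<kappa>) * (\<bar>w i\<bar> + \<bar>w (i + 1)\<bar>)"
proof -
  define W where "W = \<bar>w i\<bar> + \<bar>w (i + 1)\<bar>"
  have *: "\<bar>(p + q) / 2 - d\<bar> \<le> a + b" if "\<bar>p\<bar> \<le> a" "\<bar>q\<bar> \<le> a" "\<bar>d\<bar> \<le> b" for p q d a b :: real
    using that by (simp add: abs_le_iff field_simps)
  have "\<bar>h i (left i)\<bar> \<le> L * W" "\<bar>h i (right i)\<bar> \<le> L * W"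
    using h_lipschitz[of i "left i" 0] h_lipschitz[of i "right i" 0] abs_face_le_sum[of i] L_nonneg
    unfolding h_zero W_def[symmetric] by (auto intro: order_trans mult_left_mono)
  moreover have "\<bar>(\<alpha> / \<kappa>) * ((right i - left i) / 2)\<bar> \<le> (\<alpha> / \<kappa>) * W"
  proof -
    have "\<bar>(right i - left i) / 2\<bar> \<le> W" using abs_face_le_sum[of i] unfolding W_def[symmetric] by (simp add: abs_le_iff)
    moreover have "0 \<le> \<alpha> / \<kappa>" using alpha_nonneg kappa_pos by simp
    ultimately show ?thesis unfolding abs_mult by (metis abs_of_nonneg mult_left_mono)
  qed
  moreover have "flux i = (h i (left i) + h i (right i)) / 2 - (\<alpha> / \<kappa>) * ((right i - left i) / 2)"
    by (simp add: flux_def)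
  ultimately have "\<bar>flux i\<bar> \<le> L * W + (\<alpha> / \<kappa>) * W" by (simp only: *)
  then show ?thesis by (simp add: W_def algebra_simps)
qed

text \<open>The two face values inside a cell average to the cell value, so the outgoing fluxes take at
  most the fraction \<open>2(\<alpha> + \<kappa>L)\<close> of it.\<close>

lemma step_nonneg:
  assumes nn: "\<And>i. 0 \<le> w i"
  shows "0 \<le> step i"
proof -
  have face: "0 \<le> left i" "0 \<le> right i" for i
    using left_convex[of i] right_convex[of i] nn by (auto intro!: add_nonneg_nonneg mult_nonneg_nonneg)
  \<comment> \<open>Only the size of the flux at each face enters, through \<open>h i 0 = 0\<close>,
    so its variation between faces does not affect positivity.\<close>
  have h: "\<bar>\<kappa> * h i u\<bar> \<le> \<kappa> * L * u" if "0 \<le> u" for i u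
    using h_lipschitz[of i u 0] that kappa_pos by (simp add: h_zero abs_mult)
  \<comment> \<open>Applied to \<open>right i\<close> and \<open>left (i - 1)\<close>, which belong
    to the neighbouring cells: there the viscosity outweighs the flux, and the contribution is
    non-negative.\<close>
  have a: "\<kappa> * L * u \<le> \<alpha> * u" if "0 \<le> u" for u
    using viscosity that by (rule mult_right_mono)
  have sum: "left i + right (i - 1) = 2 * w i" by (simp add: left_def right_def)
  have "\<alpha> + \<kappa> * L \<le> (1 + \<theta>) * (\<alpha> + \<kappa> * L)"
    using theta alpha_nonneg L_nonneg kappa_pos by (simp add: algebra_simps)
  then have "(\<alpha> + \<kappa> * L) * w i \<le> 1 / 3 * w i" using cfl nn by (intro mult_right_mono) auto
  moreover have "step i = w i - (\<kappa> * h i (left i) + \<kappa> * h i (right i)) + \<alpha> * (right i - left i)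
      + (\<kappa> * h (i - 1) (left (i - 1)) + \<kappa> * h (i - 1) (right (i - 1))) - \<alpha> * (right (i - 1) - left (i - 1))"
    using kappa_pos by (simp add: step_def flux_def field_simps)
  moreover have "(\<alpha> + \<kappa> * L) * left i + (\<alpha> + \<kappa> * L) * right (i - 1) = 2 * ((\<alpha> + \<kappa> * L) * w i)"
    unfolding distrib_left[symmetric] sum by simp
  ultimately show ?thesis
    using h[OF face(1), of i i] h[OF face(2), of i i] h[OF face(1), of "i - 1" "i - 1"]
      h[OF face(2), of "i - 1" "i - 1"] a[OF face(2), of i] a[OF face(1), of "i - 1"] nn[of i]
    by (simp add: algebra_simps abs_le_iff)
qed

text \<open>With the flux function frozen at the face \<open>i - 1\<close> the new value is a convex combination of
  \<open>w (i - 1)\<close>, \<open>w i\<close> and \<open>w (i + 1)\<close>; unfreezing costs the variation of \<open>h\<close> between the faces.\<close>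

lemma abs_step_le:
  assumes S: "\<And>i. \<bar>w i\<bar> \<le> S" and D: "\<And>i u. \<bar>h i u - h (i - 1) u\<bar> \<le> D * \<bar>u\<bar>"
  shows "\<bar>step i\<bar> \<le> S * (1 + 2 * \<kappa> * D)"
proof -
  have "0 \<le> D" using D[of 0 1] by simp
  let ?l = "left i" and ?r = "right i" and ?l' = "left (i - 1)" and ?r' = "right (i - 1)" and ?k = "h (i - 1)"
  obtain p where p: "\<bar>p\<bar> \<le> L" "?k ?l - ?k ?l' = p * (?l - ?l')" using lipschitz_secant[OF h_lipschitz] by blast
  obtain q where q: "\<bar>q\<bar> \<le> L" "?k ?r - ?k ?r' = q * (?r - ?r')" using lipschitz_secant[OF h_lipschitz] by blast
  obtain c where c: "0 \<le> c" "c \<le> 1 + \<theta>" "?l - ?l' = c * (w i - w (i - 1))" using left_increment by force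
  obtain d where d: "0 \<le> d" "d \<le> 1 + \<theta>" "?r - ?r' = d * (w (i + 1) - w i)" using right_increment by force
  \<comment> \<open>\<open>a\<close> and \<open>b\<close> are the weights of
    \<open>w (i - 1)\<close> and \<open>w (i + 1)\<close>. \<open>viscosity\<close> makes them
    non-negative, and \<open>cfl\<close> bounds each by \<open>1 / 3\<close>, leaving
    \<open>1 - a - b \<ge> 0\<close> for \<open>w i\<close>.\<close>
  define a where "a = (\<alpha> + \<kappa> * p) * c"
  define b where "b = (\<alpha> - \<kappa> * q) * d"
  have "\<bar>\<kappa> * p\<bar> \<le> \<kappa> * L" "\<bar>\<kappa> * q\<bar> \<le> \<kappa> * L" using p q kappa_pos by (auto simp: abs_mult)
  then have pq: "0 \<le> \<alpha> + \<kappa> * p" "\<alpha> + \<kappa> * p \<le> \<alpha> + \<kappa> * L" "0 \<le> \<alpha> - \<kappa> * q" "\<alpha> - \<kappa> * q \<le> \<alpha> + \<kappa> * L"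
    using viscosity by linarith+
  have ab: "0 \<le> a" "0 \<le> b" using pq c d by (auto simp: a_def b_def)
  have "a \<le> (\<alpha> + \<kappa> * L) * (1 + \<theta>)" "b \<le> (\<alpha> + \<kappa> * L) * (1 + \<theta>)"
    unfolding a_def b_def using pq c d by (auto intro!: mult_mono)
  then have "a + b \<le> 1" using cfl by (simp add: mult.commute)
  define frozen where "frozen = w i - a * (w i - w (i - 1)) + b * (w (i + 1) - w i)"
  have "\<bar>(1 - a - b) * w i\<bar> \<le> (1 - a - b) * S" "\<bar>a * w (i - 1)\<bar> \<le> a * S" "\<bar>b * w (i + 1)\<bar> \<le> b * S"
    using S ab \<open>a + b \<le> 1\<close> by (auto simp: abs_mult intro!: mult_left_mono)
  then have fr: "\<bar>frozen\<bar> \<le> S" unfolding frozen_def abs_le_iff by (simp add: algebra_simps)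
  have "step i = w i - \<kappa> * ((h i ?l - ?k ?l) + (h i ?r - ?k ?r)) - \<kappa> * (?k ?l - ?k ?l')
     - \<kappa> * (?k ?r - ?k ?r') + \<alpha> * (?r - ?r') - \<alpha> * (?l - ?l')"
    using kappa_pos by (simp add: step_def flux_def field_simps)
  also have "\<dots> = frozen - \<kappa> * ((h i ?l - ?k ?l) + (h i ?r - ?k ?r))"
    unfolding p(2) q(2) c(3) d(3) frozen_def a_def b_def by (simp add: algebra_simps)
  finally have "step i = frozen - \<kappa> * ((h i ?l - ?k ?l) + (h i ?r - ?k ?r))" .
  moreover have "\<bar>\<kappa> * ((h i ?l - ?k ?l) + (h i ?r - ?k ?r))\<bar> \<le> \<kappa> * (2 * (D * S))"
  proof -
    have "\<bar>h i ?l - ?k ?l\<bar> \<le> D * S" "\<bar>h i ?r - ?k ?r\<bar> \<le> D * S"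
      using D[of i ?l] D[of i ?r] abs_face_le[OF S, of i] \<open>0 \<le> D\<close> by (meson mult_left_mono order_trans)+
    then show ?thesis using kappa_pos by (simp add: abs_mult)
  qed
  ultimately show ?thesis using fr by (simp add: algebra_simps)
qed

end

section \<open>Infinite sums over the grid\<close>

lemma infsum_weight_diff_le:
  fixes e e' r :: "'a \<Rightarrow> real"
  assumes "r summable_on UNIV" "\<And>z. 0 \<le> r z" "\<And>z. \<bar>e z\<bar> \<le> B" "\<And>z. \<bar>e' z\<bar> \<le> B" "\<And>z. \<bar>e z - e' z\<bar> \<le> K"
  shows "\<bar>(\<Sum>\<^sub>\<infinity>z. e z * r z) - (\<Sum>\<^sub>\<infinity>z. e' z * r z)\<bar> \<le> K * (\<Sum>\<^sub>\<infinity>z. r z)"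
proof -
  have *: "(\<lambda>z. norm (b z * r z)) summable_on UNIV" if "\<And>z. \<bar>b z\<bar> \<le> B'" for b B'
  proof (rule Infinite_Sum.abs_summable_on_comparison_test')
    show "(\<lambda>z. B' * r z) summable_on UNIV" using assms(1) by (rule summable_on_cmult_right)
    show "norm (b z * r z) \<le> B' * r z" for z using that[of z] assms(2)[of z] by (simp add: abs_mult mult_right_mono)
  qed
  \<comment> \<open>A divergent \<open>infsum\<close> is \<open>0\<close> by convention, so termwise
    subtraction has to be justified by summability of both series.\<close>
  have s: "(\<lambda>z. e z * r z) summable_on UNIV" "(\<lambda>z. e' z * r z) summable_on UNIV"
    using *[OF assms(3)] *[OF assms(4)] by (auto intro: abs_summable_summable)
  have "(\<Sum>\<^sub>\<infinity>z. e z * r z) - (\<Sum>\<^sub>\<infinity>z. e' z * r z) = (\<Sum>\<^sub>\<infinity>z. (e z - e' z) * r z)"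
    using infsumI[OF has_sum_add[OF s(1)[THEN has_sum_infsum] has_sum_uminusI[OF s(2)[THEN has_sum_infsum]]]]
    by (simp add: left_diff_distrib)
  also have "\<bar>\<dots>\<bar> \<le> (\<Sum>\<^sub>\<infinity>z. \<bar>(e z - e' z) * r z\<bar>)"
    using norm_infsum_bound[OF *[OF assms(5)]] by simp
  also have "\<dots> \<le> (\<Sum>\<^sub>\<infinity>z. K * r z)"
    using *[OF assms(5)] assms(1,2,5)
    by (intro infsum_mono) (auto simp: abs_mult mult_right_mono intro: summable_on_cmult_right)
  also have "\<dots> = K * (\<Sum>\<^sub>\<infinity>z. r z)" using assms(1) by (intro infsum_cmult_right) auto
  finally show ?thesis .
qed

lemma has_sum_shift:
  fixes F :: "int \<times> int \<Rightarrow> real"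
  assumes "(F has_sum s) UNIV"
  shows "((\<lambda>(i, j). F (i + a, j + b)) has_sum s) UNIV"
proof -
  have "bij (\<lambda>(i, j). (i + a, j + b) :: int \<times> int)"
    by (rule bij_betw_byWitness[where f' = "\<lambda>(i, j). (i - a, j - b)"]) auto
  from has_sum_reindex_bij_betw[OF this, of F s] assms show ?thesis
    by (simp add: case_prod_unfold)
qed

section \<open>The Euler step and the second-order scheme\<close>

text \<open>The telescoping behind conservation: \<open>F\<close> is absolutely summable, so its
  shifted copy has the same sum. The offset \<open>(a, b)\<close> will be \<open>(1, 0)\<close> or
  \<open>(0, 1)\<close>.\<close>

lemma has_sum_flux_difference:
  fixes F w :: "int \<Rightarrow> int \<Rightarrow> real"
  assumes w: "((\<lambda>(i, j). w i j) has_sum m) UNIV" and nn: "\<And>i j. 0 \<le> w i j"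
    and bound: "\<And>i j. \<bar>F i j\<bar> \<le> K * (\<bar>w i j\<bar> + \<bar>w (i + a) (j + b)\<bar>)"
  shows "((\<lambda>(i, j). F i j - F (i - a) (j - b)) has_sum 0) UNIV"
proof -
  have "((\<lambda>(i, j). w (i + a) (j + b)) has_sum m) UNIV"
    using has_sum_shift[OF w, of a b] by simp
  then have "((\<lambda>z. (case z of (i, j) \<Rightarrow> w i j) + (case z of (i, j) \<Rightarrow> w (i + a) (j + b))) has_sum (m + m)) UNIV"
    by (intro has_sum_add w)
  from has_sum_imp_summable[OF has_sum_cmult_right[OF this, of K]]
  have "(\<lambda>(i, j). K * (w i j + w (i + a) (j + b))) summable_on UNIV"
    by (simp add: case_prod_unfold)
  then have "(\<lambda>z. norm (case z of (i, j) \<Rightarrow> F i j)) summable_on UNIV"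
    using bound nn by (intro Infinite_Sum.abs_summable_on_comparison_test') auto
  then obtain s where F: "((\<lambda>(i, j). F i j) has_sum s) UNIV"
    using abs_summable_summable unfolding summable_on_def by blast
  have "((\<lambda>(i, j). F (i - a) (j - b)) has_sum s) UNIV"
    using has_sum_shift[OF F, of "- a" "- b"] by simp
  from has_sum_add[OF F has_sum_uminusI[OF this]] show ?thesis
    by (simp add: case_prod_unfold)
qed

lemma limited_slope_x:
  assumes "\<theta> \<in> {0..1}"
  shows "\<exists>c\<in>{0..\<theta>}. slope_x \<theta> r i j = 2 * c * (r i j - r (i - 1) j)"
    and "\<exists>c\<in>{0..\<theta>}. slope_x \<theta> r i j = 2 * c * (r (i + 1) j - r i j)"
  unfolding slope_x_def by (rule limited_slope; use assms in simp)+

lemma limited_slope_y: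
  assumes "\<theta> \<in> {0..1}"
  shows "\<exists>c\<in>{0..\<theta>}. slope_y \<theta> r i j = 2 * c * (r i j - r i (j - 1))"
    and "\<exists>c\<in>{0..\<theta>}. slope_y \<theta> r i j = 2 * c * (r i (j + 1) - r i j)"
  unfolding slope_y_def by (rule limited_slope; use assms in simp)+

text \<open>The form in which the hypotheses enter the discrete analysis, free of derivatives and
  essential suprema. \<open>f\<close> is moved only in \<open>x\<close> and \<open>g\<close> only in
  \<open>y\<close>, matching the position derivatives that (H1) controls.\<close>

locale scheme_setting =
  fixes f g :: "'n::finite \<Rightarrow> ('m::finite) args \<Rightarrow> real"
    and \<eta> \<nu> :: "'m \<Rightarrow> 'n \<Rightarrow> real \<times> real \<Rightarrow> real"
    and \<theta> \<alpha> \<beta> dx dy dt M B :: real and Lf Lg :: "'n \<Rightarrow> real"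
  assumes f_zero: "\<And>k t x y A. 0 \<le> t \<Longrightarrow> f k (t, x, y, 0, A) = 0"
    and g_zero: "\<And>k t x y A. 0 \<le> t \<Longrightarrow> g k (t, x, y, 0, A) = 0"
    and f_lipschitz: "\<And>k t x y u v A. 0 \<le> t \<Longrightarrow> \<bar>f k (t, x, y, u, A) - f k (t, x, y, v, A)\<bar> \<le> Lf k * \<bar>u - v\<bar>"
    and g_lipschitz: "\<And>k t x y u v A. 0 \<le> t \<Longrightarrow> \<bar>g k (t, x, y, u, A) - g k (t, x, y, v, A)\<bar> \<le> Lg k * \<bar>u - v\<bar>"
    and f_variation: "\<And>k t x y u a A A'. 0 \<le> t \<Longrightarrow> \<bar>f k (t, x + a, y, u, A) - f k (t, x, y, u, A')\<bar>
          \<le> M * \<bar>u\<bar> * (\<bar>a\<bar> + (\<Sum>q\<in>UNIV. \<bar>A $ q - A' $ q\<bar>))"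
    and g_variation: "\<And>k t x y u b A A'. 0 \<le> t \<Longrightarrow> \<bar>g k (t, x, y + b, u, A) - g k (t, x, y, u, A')\<bar>
          \<le> M * \<bar>u\<bar> * (\<bar>b\<bar> + (\<Sum>q\<in>UNIV. \<bar>A $ q - A' $ q\<bar>))"
    and eta_bound: "\<And>q k z. \<bar>\<eta> q k z\<bar> \<le> B" and nu_bound: "\<And>q k z. \<bar>\<nu> q k z\<bar> \<le> B"
    and eta_lipschitz: "\<And>q k x x' y. \<bar>\<eta> q k (x, y) - \<eta> q k (x', y)\<bar> \<le> B * \<bar>x - x'\<bar>"
    and nu_lipschitz: "\<And>q k x y y'. \<bar>\<nu> q k (x, y) - \<nu> q k (x, y')\<bar> \<le> B * \<bar>y - y'\<bar>"
    and mesh: "0 < dx" "0 < dy" "0 < dt" and M_nonneg: "0 \<le> M" and theta: "\<theta> \<in> {0..1}"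
    and viscosity_x: "\<And>k. dt / dx * Lf k \<le> \<alpha>" and cfl_x: "\<And>k. (1 + \<theta>) * (\<alpha> + dt / dx * Lf k) \<le> 1 / 3"
    and viscosity_y: "\<And>k. dt / dy * Lg k \<le> \<beta>" and cfl_y: "\<And>k. (1 + \<theta>) * (\<beta> + dt / dy * Lg k) \<le> 1 / 3"
begin

abbreviation face_flux_x :: "real \<Rightarrow> ('n \<Rightarrow> int \<Rightarrow> int \<Rightarrow> real) \<Rightarrow> 'n \<Rightarrow> int \<Rightarrow> int \<Rightarrow> real \<Rightarrow> real" where
  "face_flux_x \<tau> r k j i u \<equiv> f k (\<tau>, (of_int i + 1/2) * dx, of_int j * dy, u, conv_x \<eta> dx dy r i j)"

abbreviation face_flux_y :: "real \<Rightarrow> ('n \<Rightarrow> int \<Rightarrow> int \<Rightarrow> real) \<Rightarrow> 'n \<Rightarrow> int \<Rightarrow> int \<Rightarrow> real \<Rightarrow> real" where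
  "face_flux_y \<tau> r k i j u \<equiv> g k (\<tau>, of_int i * dx, (of_int j + 1/2) * dy, u, conv_y \<nu> dx dy r i j)"

abbreviation euler where "euler \<equiv> euler_step f g \<eta> \<nu> \<theta> \<alpha> \<beta> dx dy dt"

lemma grid_line_x:
  "0 \<le> \<tau> \<Longrightarrow> grid_line (\<lambda>i. r k i j) (\<lambda>i. slope_x \<theta> (r k) i j) (face_flux_x \<tau> r k j) \<theta> \<alpha> (dt / dx) (Lf k)"
  using f_zero f_lipschitz mesh theta viscosity_x cfl_x limited_slope_x[OF theta]
  by unfold_locales auto

lemma grid_line_y:
  "0 \<le> \<tau> \<Longrightarrow> grid_line (\<lambda>j. r k i j) (\<lambda>j. slope_y \<theta> (r k) i j) (face_flux_y \<tau> r k i) \<theta> \<beta> (dt / dy) (Lg k)"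
  using g_zero g_lipschitz mesh theta viscosity_y cfl_y limited_slope_y[OF theta]
  by unfold_locales auto

definition step_x :: "real \<Rightarrow> ('n \<Rightarrow> int \<Rightarrow> int \<Rightarrow> real) \<Rightarrow> 'n \<Rightarrow> int \<Rightarrow> int \<Rightarrow> real" where
  "step_x \<tau> r k i j =
     grid_line.step (\<lambda>i. r k i j) (\<lambda>i. slope_x \<theta> (r k) i j) (face_flux_x \<tau> r k j) \<alpha> (dt / dx) i"

definition step_y :: "real \<Rightarrow> ('n \<Rightarrow> int \<Rightarrow> int \<Rightarrow> real) \<Rightarrow> 'n \<Rightarrow> int \<Rightarrow> int \<Rightarrow> real" where
  "step_y \<tau> r k i j =
     grid_line.step (\<lambda>j. r k i j) (\<lambda>j. slope_y \<theta> (r k) i j) (face_flux_y \<tau> r k i) \<beta> (dt / dy) j"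

definition flux_x :: "real \<Rightarrow> ('n \<Rightarrow> int \<Rightarrow> int \<Rightarrow> real) \<Rightarrow> 'n \<Rightarrow> int \<Rightarrow> int \<Rightarrow> real" where
  "flux_x \<tau> r k i j =
     num_flux_x f \<eta> \<alpha> dx dy dt \<tau> r k i j (recon_x_minus \<theta> (r k) i j) (recon_x_plus \<theta> (r k) i j)"

definition flux_y :: "real \<Rightarrow> ('n \<Rightarrow> int \<Rightarrow> int \<Rightarrow> real) \<Rightarrow> 'n \<Rightarrow> int \<Rightarrow> int \<Rightarrow> real" where
  "flux_y \<tau> r k i j =
     num_flux_y g \<nu> \<beta> dx dy dt \<tau> r k i j (recon_y_minus \<theta> (r k) i j) (recon_y_plus \<theta> (r k) i j)"

lemma flux_x_eq:
  assumes "0 \<le> \<tau>"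
  shows "flux_x \<tau> r k i j =
    grid_line.flux (\<lambda>i. r k i j) (\<lambda>i. slope_x \<theta> (r k) i j) (face_flux_x \<tau> r k j) \<alpha> (dt / dx) i"
proof -
  interpret grid_line "\<lambda>i. r k i j" "\<lambda>i. slope_x \<theta> (r k) i j" "face_flux_x \<tau> r k j" \<theta> \<alpha> "dt / dx" "Lf k"
    using assms by (rule grid_line_x)
  show ?thesis
    unfolding flux_x_def num_flux_x_def Let_def flux_def left_def right_def recon_x_minus_def recon_x_plus_def ..
qed

lemma flux_y_eq:
  assumes "0 \<le> \<tau>"
  shows "flux_y \<tau> r k i j =
    grid_line.flux (\<lambda>j. r k i j) (\<lambda>j. slope_y \<theta> (r k) i j) (face_flux_y \<tau> r k i) \<beta> (dt / dy) j"
proof -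
  interpret grid_line "\<lambda>j. r k i j" "\<lambda>j. slope_y \<theta> (r k) i j" "face_flux_y \<tau> r k i" \<theta> \<beta> "dt / dy" "Lg k"
    using assms by (rule grid_line_y)
  show ?thesis
    unfolding flux_y_def num_flux_y_def Let_def flux_def left_def right_def recon_y_minus_def recon_y_plus_def ..
qed

lemma euler_eq_flux:
  "euler \<tau> r k i j = r k i j - dt / dx * (flux_x \<tau> r k i j - flux_x \<tau> r k (i - 1) j)
     - dt / dy * (flux_y \<tau> r k i j - flux_y \<tau> r k i (j - 1))"
  by (simp add: euler_step_def Let_def flux_x_def flux_y_def)

lemma euler_eq_mean:
  assumes "0 \<le> \<tau>"
  shows "euler \<tau> r k i j = (step_x \<tau> r k i j + step_y \<tau> r k i j) / 2"
proof -
  have "step_x \<tau> r k i j = r k i j - 2 * (dt / dx) * (flux_x \<tau> r k i j - flux_x \<tau> r k (i - 1) j)"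
    unfolding step_x_def flux_x_eq[OF assms] by (rule grid_line.step_def[OF grid_line_x[OF assms]])
  moreover have "step_y \<tau> r k i j = r k i j - 2 * (dt / dy) * (flux_y \<tau> r k i j - flux_y \<tau> r k i (j - 1))"
    unfolding step_y_def flux_y_eq[OF assms] by (rule grid_line.step_def[OF grid_line_y[OF assms]])
  moreover have "p - a * F - b * G = ((p - 2 * a * F) + (p - 2 * b * G)) / 2" for p a b F G :: real
    by (simp add: field_simps)
  ultimately show ?thesis unfolding euler_eq_flux by (simp only:)
qed

text \<open>Positivity is part of the notion, so \<open>dx * dy * m k\<close> is the discrete L1
  norm of component \<open>k\<close>.\<close>

definition has_mass :: "('n \<Rightarrow> int \<Rightarrow> int \<Rightarrow> real) \<Rightarrow> ('n \<Rightarrow> real) \<Rightarrow> bool" where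
  "has_mass r m \<longleftrightarrow> (\<forall>k. (\<forall>i j. 0 \<le> r k i j) \<and> ((\<lambda>(i, j). r k i j) has_sum m k) UNIV)"

lemma euler_has_mass:
  assumes \<tau>: "0 \<le> \<tau>" and m: "has_mass r m"
  shows "has_mass (euler \<tau> r) m"
  unfolding has_mass_def
proof (intro allI conjI)
  fix k i j
  have nn: "0 \<le> r k i j" for i j using m by (simp add: has_mass_def)
  show "0 \<le> euler \<tau> r k i j"
    using grid_line.step_nonneg[OF grid_line_x[OF \<tau>], of r k j i, OF nn]
      grid_line.step_nonneg[OF grid_line_y[OF \<tau>], of r k i j, OF nn]
    by (simp add: euler_eq_mean[OF \<tau>] step_x_def step_y_def)
  have r: "((\<lambda>(i, j). r k i j) has_sum m k) UNIV" using m by (simp add: has_mass_def)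
  \<comment> \<open>\<open>j - 0\<close> puts the difference into the shape of
    \<open>has_sum_flux_difference\<close> with offset \<open>(1, 0)\<close>.\<close>
  have "((\<lambda>(i, j). flux_x \<tau> r k i j - flux_x \<tau> r k (i - 1) (j - 0)) has_sum 0) UNIV"
    using grid_line.abs_flux_le[OF grid_line_x[OF \<tau>], of r k]
    by (intro has_sum_flux_difference[OF r nn]) (auto simp: flux_x_eq[OF \<tau>])
  from has_sum_cmult_right[OF this, of "- (dt / dx)"]
  have x: "((\<lambda>(i, j). - (dt / dx) * (flux_x \<tau> r k i j - flux_x \<tau> r k (i - 1) j)) has_sum 0) UNIV"
    by (simp add: case_prod_unfold)
  have "((\<lambda>(i, j). flux_y \<tau> r k i j - flux_y \<tau> r k (i - 0) (j - 1)) has_sum 0) UNIV"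
    using grid_line.abs_flux_le[OF grid_line_y[OF \<tau>], of r k]
    by (intro has_sum_flux_difference[OF r nn]) (auto simp: flux_y_eq[OF \<tau>])
  from has_sum_cmult_right[OF this, of "- (dt / dy)"]
  have y: "((\<lambda>(i, j). - (dt / dy) * (flux_y \<tau> r k i j - flux_y \<tau> r k i (j - 1))) has_sum 0) UNIV"
    by (simp add: case_prod_unfold)
  show "((\<lambda>(i, j). euler \<tau> r k i j) has_sum m k) UNIV"
    using has_sum_add[OF has_sum_add[OF r x] y] by (simp add: euler_eq_flux case_prod_unfold algebra_simps)
qed

section \<open>Variation of the discrete convolutions and growth of one Euler step\<close>

lemma sum_abs_le_of_components:
  fixes v v' :: "real ^ 'm"
  assumes "\<And>q. \<bar>v $ q - v' $ q\<bar> \<le> K"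
  shows "(\<Sum>q\<in>UNIV. \<bar>v $ q - v' $ q\<bar>) \<le> real CARD('m) * K"
  using sum_bounded_above[of UNIV "\<lambda>q. \<bar>v $ q - v' $ q\<bar>" K] assms by simp

lemma weighted_sums_diff_le:
  fixes e e' :: "'n \<Rightarrow> int \<times> int \<Rightarrow> real"
  assumes m: "has_mass r m" and "\<And>k z. \<bar>e k z\<bar> \<le> B" "\<And>k z. \<bar>e' k z\<bar> \<le> B"
    and "\<And>k z. \<bar>e k z - e' k z\<bar> \<le> K"
  shows "\<bar>dx * dy * (\<Sum>k\<in>UNIV. \<Sum>\<^sub>\<infinity>(l, p). e k (l, p) * r k l p)
      - dx * dy * (\<Sum>k\<in>UNIV. \<Sum>\<^sub>\<infinity>(l, p). e' k (l, p) * r k l p)\<bar> \<le> K * (dx * dy * sum m UNIV)"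
proof -
  have "\<bar>(\<Sum>\<^sub>\<infinity>(l, p). e k (l, p) * r k l p) - (\<Sum>\<^sub>\<infinity>(l, p). e' k (l, p) * r k l p)\<bar> \<le> K * m k" for k
  proof -
    have r: "((\<lambda>(i, j). r k i j) has_sum m k) UNIV" and nn: "\<And>i j. 0 \<le> r k i j"
      using m by (auto simp: has_mass_def)
    show ?thesis
      using infsum_weight_diff_le[of "\<lambda>(i, j). r k i j" "e k" B "e' k" K] assms(2-4) nn
        infsumI[OF r] has_sum_imp_summable[OF r]
      by (simp add: case_prod_unfold)
  qed
  then have "\<bar>(\<Sum>k\<in>UNIV. \<Sum>\<^sub>\<infinity>(l, p). e k (l, p) * r k l p) - (\<Sum>k\<in>UNIV. \<Sum>\<^sub>\<infinity>(l, p). e' k (l, p) * r k l p)\<bar>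
      \<le> (\<Sum>k\<in>UNIV. K * m k)"
    unfolding sum_subtractf[symmetric] by (intro order_trans[OF sum_abs] sum_mono)
  then have "\<bar>dx * dy\<bar> * \<bar>(\<Sum>k\<in>UNIV. \<Sum>\<^sub>\<infinity>(l, p). e k (l, p) * r k l p)
      - (\<Sum>k\<in>UNIV. \<Sum>\<^sub>\<infinity>(l, p). e' k (l, p) * r k l p)\<bar> \<le> \<bar>dx * dy\<bar> * (\<Sum>k\<in>UNIV. K * m k)"
    by (rule mult_left_mono) simp
  then show ?thesis
    using mesh by (simp only: abs_mult[symmetric] right_diff_distrib) (simp add: sum_distrib_left mult_ac)
qed

text \<open>Discrete counterpart of bounding the \<open>x\<close>-derivative of a convolution by the
  sup norm of the kernel's derivative times the L1 norm of the density.\<close>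

lemma conv_x_diff_le:
  assumes "has_mass r m"
  shows "\<bar>conv_x \<eta> dx dy r i j $ q - conv_x \<eta> dx dy r (i - 1) j $ q\<bar> \<le> B * dx * (dx * dy * sum m UNIV)"
proof -
  define e where "e i k = (\<lambda>(l, p). \<eta> q k ((of_int i + 1/2) * dx - of_int l * dx, of_int j * dy - of_int p * dy))"
    for i :: int and k
  have "\<bar>e i k z - e (i - 1) k z\<bar> \<le> B * dx" for k z
  proof (cases z)
    case (Pair l p)
    have "\<bar>e i k z - e (i - 1) k z\<bar> \<le> B * \<bar>((of_int i + 1/2) * dx - of_int l * dx) - ((of_int (i - 1) + 1/2) * dx - of_int l * dx)\<bar>"
      unfolding e_def Pair prod.case by (rule eta_lipschitz)
    then show ?thesis using mesh by (simp add: algebra_simps)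
  qed
  moreover have "\<bar>e i k z\<bar> \<le> B" for i k z by (simp add: e_def eta_bound split: prod.split)
  moreover have "conv_x \<eta> dx dy r i j $ q = dx * dy * (\<Sum>k\<in>UNIV. \<Sum>\<^sub>\<infinity>(l, p). e i k (l, p) * r k l p)" for i
    by (simp only: conv_x_def e_def vec_lambda_beta prod.case)
  ultimately show ?thesis by (simp only: weighted_sums_diff_le[OF assms])
qed

lemma conv_y_diff_le:
  assumes "has_mass r m"
  shows "\<bar>conv_y \<nu> dx dy r i j $ q - conv_y \<nu> dx dy r i (j - 1) $ q\<bar> \<le> B * dy * (dx * dy * sum m UNIV)"
proof -
  define e where "e j k = (\<lambda>(l, p). \<nu> q k (of_int i * dx - of_int l * dx, (of_int j + 1/2) * dy - of_int p * dy))"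
    for j :: int and k
  have "\<bar>e j k z - e (j - 1) k z\<bar> \<le> B * dy" for k z
  proof (cases z)
    case (Pair l p)
    have "\<bar>e j k z - e (j - 1) k z\<bar> \<le> B * \<bar>((of_int j + 1/2) * dy - of_int p * dy) - ((of_int (j - 1) + 1/2) * dy - of_int p * dy)\<bar>"
      unfolding e_def Pair prod.case by (rule nu_lipschitz)
    then show ?thesis using mesh by (simp add: algebra_simps)
  qed
  moreover have "\<bar>e j k z\<bar> \<le> B" for j k z by (simp add: e_def nu_bound split: prod.split)
  moreover have "conv_y \<nu> dx dy r i j $ q = dx * dy * (\<Sum>k\<in>UNIV. \<Sum>\<^sub>\<infinity>(l, p). e j k (l, p) * r k l p)" for j
    by (simp only: conv_y_def e_def vec_lambda_beta prod.case)
  ultimately show ?thesis by (simp only: weighted_sums_diff_le[OF assms])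
qed

text \<open>The 2 stems from the doubled ratio, the 1 from the explicit dependence on position, and
  the rest from the change of the \<open>CARD('m)\<close> convolutions.\<close>

definition growth :: "real \<Rightarrow> real" where
  "growth W = 2 * M * (1 + real CARD('m) * (B * W))"

lemma growth_nonneg: "0 \<le> W \<Longrightarrow> 0 \<le> growth W"
  using M_nonneg order_trans[OF abs_ge_zero eta_bound] by (simp add: growth_def)

text \<open>Between two faces the flux changes by a multiple of \<open>dx\<close>, which cancels the
  denominator of \<open>dt / dx\<close>; the excess is of order \<open>dt\<close>, uniformly in the
  mesh. \<open>W\<close> stands in for the mass, which depends on the mesh.\<close>

lemma abs_euler_le:
  assumes \<tau>: "0 \<le> \<tau>" and m: "has_mass r m" and W: "dx * dy * sum m UNIV \<le> W"
    and S: "\<And>k i j. \<bar>r k i j\<bar> \<le> S"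
  shows "\<bar>euler \<tau> r k i j\<bar> \<le> S * (1 + growth W * dt)"
proof -
  have B: "0 \<le> B" using order_trans[OF abs_ge_zero eta_bound] .
  define c where "c = 1 + real CARD('m) * (B * W)"
  have sumx: "dx + (\<Sum>q\<in>UNIV. \<bar>conv_x \<eta> dx dy r i j $ q - conv_x \<eta> dx dy r (i - 1) j $ q\<bar>) \<le> dx * c" for i j
  proof -
    have "B * dx * (dx * dy * sum m UNIV) \<le> B * dx * W" using B mesh W by (intro mult_left_mono) auto
    with conv_x_diff_le[OF m] have "\<bar>conv_x \<eta> dx dy r i j $ q - conv_x \<eta> dx dy r (i - 1) j $ q\<bar> \<le> B * dx * W" for q
      by (rule order_trans)
    from sum_abs_le_of_components[OF this] show ?thesis by (simp add: c_def algebra_simps)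
  qed
  have sumy: "dy + (\<Sum>q\<in>UNIV. \<bar>conv_y \<nu> dx dy r i j $ q - conv_y \<nu> dx dy r i (j - 1) $ q\<bar>) \<le> dy * c" for i j
  proof -
    have "B * dy * (dx * dy * sum m UNIV) \<le> B * dy * W" using B mesh W by (intro mult_left_mono) auto
    with conv_y_diff_le[OF m] have "\<bar>conv_y \<nu> dx dy r i j $ q - conv_y \<nu> dx dy r i (j - 1) $ q\<bar> \<le> B * dy * W" for q
      by (rule order_trans)
    from sum_abs_le_of_components[OF this] show ?thesis by (simp add: c_def algebra_simps)
  qed
  have "\<bar>face_flux_x \<tau> r k j i u - face_flux_x \<tau> r k j (i - 1) u\<bar> \<le> (M * (dx * c)) * \<bar>u\<bar>" for i u
  proof -
    \<comment> \<open>Writes the face as its left neighbour shifted by \<open>dx\<close>, the form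
      in which \<open>f_variation\<close> applies.\<close>
    have "(of_int i + 1/2) * dx = (of_int (i - 1) + 1/2) * dx + dx" by (simp add: algebra_simps)
    then have "\<bar>face_flux_x \<tau> r k j i u - face_flux_x \<tau> r k j (i - 1) u\<bar>
        \<le> M * \<bar>u\<bar> * (\<bar>dx\<bar> + (\<Sum>q\<in>UNIV. \<bar>conv_x \<eta> dx dy r i j $ q - conv_x \<eta> dx dy r (i - 1) j $ q\<bar>))"
      by (simp only: f_variation[OF \<tau>])
    also have "\<dots> \<le> M * \<bar>u\<bar> * (dx * c)"
      using sumx[of i j] mesh M_nonneg by (intro mult_left_mono) auto
    finally show ?thesis by (simp add: mult_ac)
  qed
  from grid_line.abs_step_le[OF grid_line_x[OF \<tau>] S this]
  have x: "\<bar>step_x \<tau> r k i j\<bar> \<le> S * (1 + 2 * (dt / dx) * (M * (dx * c)))"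
    unfolding step_x_def .
  have "\<bar>face_flux_y \<tau> r k i j u - face_flux_y \<tau> r k i (j - 1) u\<bar> \<le> (M * (dy * c)) * \<bar>u\<bar>" for j u
  proof -
    have "(of_int j + 1/2) * dy = (of_int (j - 1) + 1/2) * dy + dy" by (simp add: algebra_simps)
    then have "\<bar>face_flux_y \<tau> r k i j u - face_flux_y \<tau> r k i (j - 1) u\<bar>
        \<le> M * \<bar>u\<bar> * (\<bar>dy\<bar> + (\<Sum>q\<in>UNIV. \<bar>conv_y \<nu> dx dy r i j $ q - conv_y \<nu> dx dy r i (j - 1) $ q\<bar>))"
      by (simp only: g_variation[OF \<tau>])
    also have "\<dots> \<le> M * \<bar>u\<bar> * (dy * c)"
      using sumy[of i j] mesh M_nonneg by (intro mult_left_mono) auto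
    finally show ?thesis by (simp add: mult_ac)
  qed
  from grid_line.abs_step_le[OF grid_line_y[OF \<tau>] S this]
  have y: "\<bar>step_y \<tau> r k i j\<bar> \<le> S * (1 + 2 * (dt / dy) * (M * (dy * c)))"
    unfolding step_y_def .
  have "2 * (dt / dx) * (M * (dx * c)) = growth W * dt" "2 * (dt / dy) * (M * (dy * c)) = growth W * dt"
    using mesh by (simp_all add: growth_def c_def)
  then show ?thesis
    using x y unfolding euler_eq_mean[OF \<tau>] by (simp add: abs_le_iff)
qed

section \<open>Iteration in time\<close>

abbreviation solution where "solution \<equiv> scheme f g \<eta> \<nu> \<theta> \<alpha> \<beta> dx dy dt"

text \<open>The mass is carried along in the induction because each Euler estimate needs positivity
  and the same bound \<open>W\<close> for its input.\<close>

lemma abs_solution_le: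
  assumes m: "has_mass (cell_averages dx dy \<rho>\<^sub>0) m" and W: "dx * dy * sum m UNIV \<le> W" "0 \<le> W"
    and S: "\<And>k i j. \<bar>cell_averages dx dy \<rho>\<^sub>0 k i j\<bar> \<le> S"
  shows "has_mass (solution \<rho>\<^sub>0 n) m \<and>
    (\<forall>k i j. \<bar>solution \<rho>\<^sub>0 n k i j\<bar> \<le> S * exp (2 * growth W * (real n * dt)))"
proof (induction n)
  case 0
  then show ?case using m S by simp
next
  case (Suc n)
  define c where "c = growth W * dt"
  define S' where "S' = S * exp (2 * growth W * (real n * dt))"
  define r where "r = solution \<rho>\<^sub>0 n"
  define r1 where "r1 = euler (real n * dt) r"
  define r2 where "r2 = euler (real (Suc n) * dt) r1"
  have \<tau>: "0 \<le> real n * dt" "0 \<le> real (Suc n) * dt" using mesh by auto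
  have r: "has_mass r m" "\<bar>r k i j\<bar> \<le> S'" for k i j using Suc by (auto simp: r_def S'_def)
  have r1: "has_mass r1 m" "\<bar>r1 k i j\<bar> \<le> S' * (1 + c)" for k i j
    unfolding r1_def c_def using \<tau> r W by (auto intro!: euler_has_mass abs_euler_le)
  have r2: "has_mass r2 m" "\<bar>r2 k i j\<bar> \<le> S' * (1 + c) * (1 + c)" for k i j
    unfolding r2_def using \<tau> r1 W unfolding c_def by (auto intro!: euler_has_mass abs_euler_le)
  have sol: "solution \<rho>\<^sub>0 (Suc n) = (\<lambda>k i j. (r k i j + r2 k i j) / 2)"
    by (simp add: r_def r1_def r2_def Let_def)
  have "has_mass (\<lambda>k i j. (r k i j + r2 k i j) / 2) m"
    unfolding has_mass_def
  proof (intro allI conjI)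
    fix k i j
    show "0 \<le> (r k i j + r2 k i j) / 2" using r(1) r2(1) by (simp add: has_mass_def)
    have "((\<lambda>z. (case z of (i, j) \<Rightarrow> r k i j) + (case z of (i, j) \<Rightarrow> r2 k i j)) has_sum (m k + m k)) UNIV"
      using r(1) r2(1) by (intro has_sum_add) (auto simp: has_mass_def)
    from has_sum_cmult_right[OF this, of "1/2"]
    show "((\<lambda>(i, j). (r k i j + r2 k i j) / 2) has_sum m k) UNIV" by (simp add: case_prod_unfold)
  qed
  moreover have "\<bar>(r k i j + r2 k i j) / 2\<bar> \<le> S * exp (2 * growth W * (real (Suc n) * dt))" for k i j
  proof -
    have "0 \<le> S'" using r(2)[of undefined 0 0] by simp
    have "0 \<le> c" using growth_nonneg[OF W(2)] mesh by (simp add: c_def)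
    then have "1 \<le> exp c * exp c" by (metis mult_exp_exp add_nonneg_nonneg one_le_exp_iff)
    moreover have "(1 + c) * (1 + c) \<le> exp c * exp c"
      using \<open>0 \<le> c\<close> by (intro mult_mono exp_ge_add_one_self) auto
    ultimately have "(1 + (1 + c) * (1 + c)) / 2 \<le> exp c * exp c" by simp
    then have "S' * ((1 + (1 + c) * (1 + c)) / 2) \<le> S' * (exp c * exp c)"
      using \<open>0 \<le> S'\<close> by (rule mult_left_mono)
    moreover have "S' * (exp c * exp c) = S * exp (2 * growth W * (real (Suc n) * dt))"
      unfolding S'_def c_def by (simp add: mult_exp_exp algebra_simps)
    moreover have "\<bar>(r k i j + r2 k i j) / 2\<bar> \<le> S' * ((1 + (1 + c) * (1 + c)) / 2)"
      using r(2)[of k i j] r2(2)[of k i j] by (simp add: abs_le_iff algebra_simps)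
    ultimately show ?thesis by linarith
  qed
  ultimately show ?case unfolding sol by blast
qed

end

section \<open>Cell averages and the sup norm of grid functions\<close>

lemma cell_iff_floor:
  assumes "0 < dx" "0 < dy"
  shows "(x, y) \<in> cell dx dy i j \<longleftrightarrow> \<lfloor>x / dx + 1/2\<rfloor> = i \<and> \<lfloor>y / dy + 1/2\<rfloor> = j"
  using assms unfolding cell_def floor_eq_iff by (auto simp: field_simps)

lemma cell_measurable [measurable]: "cell dx dy i j \<in> sets lebesgue"
  by (simp add: cell_def borel_Times sets_completionI_sets)

text \<open>Half-open cells partition the plane, so only the cell given by the floors of
  \<open>z\<close> can contribute.\<close>

lemma sum_indicator_cell_le_1:
  assumes "0 < dx" "0 < dy" "finite P"
  shows "(\<Sum>(i, j)\<in>P. indicator (cell dx dy i j) z) \<le> (1 :: real)"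
proof (cases z)
  case (Pair x y)
  define p where "p = (\<lfloor>x / dx + 1/2\<rfloor>, \<lfloor>y / dy + 1/2\<rfloor>)"
  have "(\<Sum>(i, j)\<in>P. indicator (cell dx dy i j) z) = (\<Sum>q\<in>P. if q = p then 1 else (0 :: real))"
    by (rule sum.cong) (auto simp: indicator_def Pair cell_iff_floor[OF assms(1,2)] p_def)
  then show ?thesis using assms(3) by (simp add: sum.delta)
qed

text \<open>Finitely many disjoint cells carry at most the whole integral of a non-negative datum;
  bounded partial sums then give summability and a bound independent of the mesh.\<close>

lemma cell_averages_mass:
  assumes "0 < dx" "0 < dy" and int: "integrable lebesgue (\<rho>\<^sub>0 k)" and nn: "AE z in lebesgue. 0 \<le> \<rho>\<^sub>0 k z"
  shows "0 \<le> cell_averages dx dy \<rho>\<^sub>0 k i j"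
    and "(\<lambda>(i, j). cell_averages dx dy \<rho>\<^sub>0 k i j) summable_on UNIV"
    and "dx * dy * (\<Sum>\<^sub>\<infinity>(i, j). cell_averages dx dy \<rho>\<^sub>0 k i j) \<le> (LINT z|lebesgue. \<rho>\<^sub>0 k z)"
proof -
  define I where "I = (LINT z|lebesgue. \<rho>\<^sub>0 k z)"
  have nonneg: "0 \<le> cell_averages dx dy \<rho>\<^sub>0 k i j" for i j
    unfolding cell_averages_def set_lebesgue_integral_def
    using assms(1,2) nn by (intro mult_nonneg_nonneg integral_nonneg_AE) (auto elim!: eventually_mono)
  have intc: "integrable lebesgue (\<lambda>z. indicator (cell dx dy i j) z * \<rho>\<^sub>0 k z)" for i j
    using integrable_mult_indicator[OF cell_measurable int] by simp
  have partial: "(\<Sum>(i, j)\<in>P. cell_averages dx dy \<rho>\<^sub>0 k i j) \<le> I / (dx * dy)" if "finite P" for P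
  proof -
    have "(\<Sum>(i, j)\<in>P. LINT z:cell dx dy i j|lebesgue. \<rho>\<^sub>0 k z)
        = (LINT z|lebesgue. (\<Sum>(i, j)\<in>P. indicator (cell dx dy i j) z * \<rho>\<^sub>0 k z))"
      unfolding set_lebesgue_integral_def case_prod_unfold real_scaleR_def
      by (subst Bochner_Integration.integral_sum) (auto intro: intc)
    also have "\<dots> \<le> I"
      unfolding I_def
    proof (rule integral_mono_AE)
      show "integrable lebesgue (\<lambda>z. \<Sum>(i, j)\<in>P. indicator (cell dx dy i j) z * \<rho>\<^sub>0 k z)"
        unfolding case_prod_unfold by (intro Bochner_Integration.integrable_sum intc)
      show "AE z in lebesgue. (\<Sum>(i, j)\<in>P. indicator (cell dx dy i j) z * \<rho>\<^sub>0 k z) \<le> \<rho>\<^sub>0 k z"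
        using nn
      proof eventually_elim
        case (elim z)
        have "(\<Sum>(i, j)\<in>P. indicator (cell dx dy i j) z * \<rho>\<^sub>0 k z) = (\<Sum>(i, j)\<in>P. indicator (cell dx dy i j) z) * \<rho>\<^sub>0 k z"
          by (simp add: sum_distrib_right case_prod_unfold)
        also have "\<dots> \<le> 1 * \<rho>\<^sub>0 k z"
          using elim sum_indicator_cell_le_1[OF assms(1,2) that] by (intro mult_right_mono)
        finally show ?case by simp
      qed
    qed (fact int)
    finally have "(\<Sum>(i, j)\<in>P. LINT z:cell dx dy i j|lebesgue. \<rho>\<^sub>0 k z) / (dx * dy) \<le> I / (dx * dy)"
      using assms(1,2) by (intro divide_right_mono) auto
    then show ?thesis by (simp add: cell_averages_def sum_divide_distrib case_prod_unfold)
  qed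
  have summ: "(\<lambda>(i, j). cell_averages dx dy \<rho>\<^sub>0 k i j) summable_on UNIV"
    using partial nonneg by (intro nonneg_bdd_above_summable_on) (auto intro!: bdd_aboveI[of _ "I / (dx * dy)"])
  have "(\<Sum>\<^sub>\<infinity>(i, j). cell_averages dx dy \<rho>\<^sub>0 k i j) \<le> I / (dx * dy)"
    using partial by (intro infsum_le_finite_sums[OF summ]) auto
  then have "dx * dy * (\<Sum>\<^sub>\<infinity>(i, j). cell_averages dx dy \<rho>\<^sub>0 k i j) \<le> I"
    using assms(1,2) by (simp add: pos_le_divide_eq mult.commute)
  then show "dx * dy * (\<Sum>\<^sub>\<infinity>(i, j). cell_averages dx dy \<rho>\<^sub>0 k i j) \<le> (LINT z|lebesgue. \<rho>\<^sub>0 k z)"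
    by (simp only: I_def)
  show "0 \<le> cell_averages dx dy \<rho>\<^sub>0 k i j" by (rule nonneg)
  show "(\<lambda>(i, j). cell_averages dx dy \<rho>\<^sub>0 k i j) summable_on UNIV" by (rule summ)
qed

text \<open>The function factors through the countable discrete space of index pairs, on which every
  function is measurable.\<close>

lemma grid_function_measurable:
  "(\<lambda>(x, y). v \<lfloor>x / dx + 1/2\<rfloor> \<lfloor>y / dy + 1/2\<rfloor> :: real) \<in> borel_measurable (lebesgue :: (real \<times> real) measure)"
proof -
  have "(\<lambda>z. (\<lfloor>fst z / dx + 1/2\<rfloor>, \<lfloor>snd z / dy + 1/2\<rfloor>))
      \<in> (borel :: (real \<times> real) measure) \<rightarrow>\<^sub>M count_space UNIV \<Otimes>\<^sub>M count_space UNIV"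
    unfolding borel_prod[symmetric] by measurable
  then have "(\<lambda>z. (\<lfloor>fst z / dx + 1/2\<rfloor>, \<lfloor>snd z / dy + 1/2\<rfloor>)) \<in> (borel :: (real \<times> real) measure) \<rightarrow>\<^sub>M count_space UNIV"
    by (simp add: pair_measure_countable)
  then have "(\<lambda>z. (\<lambda>(i, j). v i j) (\<lfloor>fst z / dx + 1/2\<rfloor>, \<lfloor>snd z / dy + 1/2\<rfloor>)) \<in> borel_measurable (borel :: (real \<times> real) measure)"
    by (rule measurable_compose) simp
  then show ?thesis
    by (intro measurable_completion) (simp add: case_prod_unfold)
qed

text \<open>Besides the pointwise bound this requires measurability: the norm of a non-measurable
  function is \<infinity>.\<close>

lemma Linf_norm_grid_function_le:
  fixes v :: "int \<Rightarrow> int \<Rightarrow> real" and dx dy :: real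
  assumes "\<And>i j. \<bar>v i j\<bar> \<le> S"
  shows "Linf_norm UNIV (\<lambda>(x, y). v \<lfloor>x / dx + 1/2\<rfloor> \<lfloor>y / dy + 1/2\<rfloor>) \<le> ereal S"
  unfolding Linf_norm_def
proof (rule esssup_I)
  show "(\<lambda>z. ereal \<bar>(case z of (x, y) \<Rightarrow> v \<lfloor>x / dx + 1/2\<rfloor> \<lfloor>y / dy + 1/2\<rfloor>)\<bar>) \<in> borel_measurable (lebesgue_on UNIV)"
    using grid_function_measurable[of v dx dy] by (simp add: lebesgue_on_UNIV_eq)
qed (auto simp: assms)

text \<open>Each value is attained on the interior of a cell, which is not negligible, so no cell
  can hide from the essential supremum.\<close>

lemma abs_le_Linf_norm_grid_function:
  fixes v :: "int \<Rightarrow> int \<Rightarrow> real" and dx dy :: real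
  assumes "0 < dx" "0 < dy" and fin: "Linf_norm UNIV (\<lambda>(x, y). v \<lfloor>x / dx + 1/2\<rfloor> \<lfloor>y / dy + 1/2\<rfloor>) \<le> ereal S"
  shows "\<bar>v i j\<bar> \<le> S"
proof (rule ccontr)
  assume neg: "\<not> \<bar>v i j\<bar> \<le> S"
  let ?u = "\<lambda>(x, y). v \<lfloor>x / dx + 1/2\<rfloor> \<lfloor>y / dy + 1/2\<rfloor>"
  let ?box = "{(of_int i - 1/2) * dx <..< (of_int i + 1/2) * dx} \<times> {(of_int j - 1/2) * dy <..< (of_int j + 1/2) * dy}"
  have "AE z in lebesgue. ereal \<bar>?u z\<bar> \<le> Linf_norm UNIV ?u"
    unfolding Linf_norm_def by (subst lebesgue_on_UNIV_eq[symmetric]) (rule esssup_AE)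
  then have "AE z in lebesgue. \<bar>?u z\<bar> \<le> S"
  proof eventually_elim
    case (elim z)
    from order_trans[OF elim fin] show ?case by simp
  qed
  then obtain N where "N \<in> null_sets lebesgue" "{z. \<not> \<bar>?u z\<bar> \<le> S} \<subseteq> N"
    by (auto simp: eventually_ae_filter)
  moreover have "?box \<subseteq> {z. \<not> \<bar>?u z\<bar> \<le> S}"
  proof
    fix z assume z: "z \<in> ?box"
    obtain x y where xy: "z = (x, y)" by (cases z)
    have "(x, y) \<in> cell dx dy i j" using z by (auto simp: cell_def xy)
    then show "z \<in> {z. \<not> \<bar>?u z\<bar> \<le> S}" using neg by (simp add: xy cell_iff_floor[OF assms(1,2)])
  qed
  ultimately have "negligible ?box"
    by (meson negligible_iff_null_sets negligible_subset)
  moreover have "open ?box" "?box \<noteq> {}"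
    using assms(1,2) by (simp_all add: open_Times algebra_simps not_le)
  ultimately show False using open_not_negligible by blast
qed

lemma sup_norm_le_iff: "sup_norm u \<le> c \<longleftrightarrow> (\<forall>k. Linf_norm UNIV (u k) \<le> c)"
  by (auto simp: sup_norm_def)

section \<open>From the hypotheses to the discrete setting\<close>

lemma cfl_consequences:
  fixes L :: real
  assumes cfl: "2 * dt / d \<le> Min {1, 4 - 6 * (2 * \<alpha>) * (1 + \<theta>), 6 * (2 * \<alpha>)} / (6 * (1 + \<theta>) * L + 1)"
    and "0 \<le> L" "0 \<le> \<theta>" "0 < d" "0 < dt"
  shows "dt / d * L \<le> \<alpha>" "(1 + \<theta>) * (\<alpha> + dt / d * L) \<le> 1 / 3"
proof -
  define \<kappa> where "\<kappa> = dt / d"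
  have \<kappa>: "0 < \<kappa>" using assms by (simp add: \<kappa>_def)
  have pos: "0 < 6 * (1 + \<theta>) * L + 1" using assms by (simp add: add_nonneg_pos)
  have "2 * \<kappa> * (6 * (1 + \<theta>) * L + 1) \<le> Min {1, 4 - 6 * (2 * \<alpha>) * (1 + \<theta>), 6 * (2 * \<alpha>)}"
    using cfl unfolding pos_le_divide_eq[OF pos] \<kappa>_def by simp
  \<comment> \<open>Dividing by 12 and dropping the term \<open>2 * \<kappa>\<close>, the entry
    \<open>6 * (2 * \<alpha>)\<close> yields the first claim and the entry with \<open>4\<close> the
    second.\<close>
  then have *: "2 * \<kappa> * (6 * (1 + \<theta>) * L + 1) \<le> 6 * (2 * \<alpha>)"
    "2 * \<kappa> * (6 * (1 + \<theta>) * L + 1) \<le> 4 - 6 * (2 * \<alpha>) * (1 + \<theta>)"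
    by simp_all
  have "0 \<le> \<theta> * (\<kappa> * L)" using assms \<kappa> by simp
  then show "dt / d * L \<le> \<alpha>" "(1 + \<theta>) * (\<alpha> + dt / d * L) \<le> 1 / 3"
    using * \<kappa> unfolding \<kappa>_def[symmetric] by (simp_all add: algebra_simps)
qed

text \<open>There are finitely many kernels, so the largest of their constants serves all of
  them.\<close>

lemma kernels_bounded_lipschitz:
  fixes \<eta> \<nu> :: "'m::finite \<Rightarrow> 'n::finite \<Rightarrow> real \<times> real \<Rightarrow> real"
  assumes "kernel_regular \<eta>" "kernel_regular \<nu>"
  obtains B where "\<And>q k z. \<bar>\<eta> q k z\<bar> \<le> B" "\<And>q k z. \<bar>\<nu> q k z\<bar> \<le> B"
    "\<And>q k x x' y. \<bar>\<eta> q k (x, y) - \<eta> q k (x', y)\<bar> \<le> B * \<bar>x - x'\<bar>"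
    "\<And>q k x y y'. \<bar>\<nu> q k (x, y) - \<nu> q k (x, y')\<bar> \<le> B * \<bar>y - y'\<bar>"
proof -
  define good where "good u B \<longleftrightarrow> (\<forall>z. \<bar>u z\<bar> \<le> B) \<and> (\<forall>x x' y. \<bar>u (x, y) - u (x', y)\<bar> \<le> B * \<bar>x - x'\<bar>)
      \<and> (\<forall>x y y'. \<bar>u (x, y) - u (x, y')\<bar> \<le> B * \<bar>y - y'\<bar>)" for u :: "real \<times> real \<Rightarrow> real" and B
  have mono: "good u B'" if "good u B" "B \<le> B'" for u B B'
    using that unfolding good_def by (meson abs_ge_zero mult_right_mono order_trans)
  have "\<exists>B. good (\<eta> q k) B" "\<exists>B. good (\<nu> q k) B" for q k
    using assms kernel_bounded_lipschitz unfolding kernel_regular_def good_def by metis+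
  then obtain b c where bc: "good (\<eta> q k) (b q k)" "good (\<nu> q k) (c q k)" for q k by metis
  define B where "B = Max (range (case_prod b) \<union> range (case_prod c))"
  have "b q k \<le> B" "c q k \<le> B" for q k
    unfolding B_def by (rule Max_ge; force)+
  then have "good (\<eta> q k) B" "good (\<nu> q k) B" for q k using bc mono by blast+
  then show thesis by (intro that[of B]) (auto simp: good_def)
qed

lemma flux_x_variation:
  assumes "flux_regular f" "flux_growth M f g" "0 \<le> t"
  shows "\<bar>f k (t, x + a, y, u, A) - f k (t, x, y, u, A')\<bar> \<le> M * \<bar>u\<bar> * (\<bar>a\<bar> + (\<Sum>q\<in>UNIV. \<bar>A $ q - A' $ q\<bar>))"
proof -
  have "\<bar>a * D_x (f k) (t, x, y, u, A)\<bar> \<le> \<bar>a\<bar> * (M * \<bar>u\<bar>)" for x y A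
    using assms(2,3) unfolding abs_mult flux_growth_def by (intro mult_left_mono) auto
  \<comment> \<open>With \<open>b = 0\<close> the condition on \<open>D_y (f k)\<close>, which (H1)
    does not bound, becomes trivial.\<close>
  then show ?thesis
    using flux_variation_position[of "f k" t a u "M * \<bar>u\<bar>" 0 x y A A'] assms
    by (auto simp: flux_regular_def flux_growth_def)
qed

lemma flux_y_variation:
  assumes "flux_regular g" "flux_growth M f g" "0 \<le> t"
  shows "\<bar>g k (t, x, y + b, u, A) - g k (t, x, y, u, A')\<bar> \<le> M * \<bar>u\<bar> * (\<bar>b\<bar> + (\<Sum>q\<in>UNIV. \<bar>A $ q - A' $ q\<bar>))"
proof -
  have "\<bar>b * D_y (g k) (t, x, y, u, A)\<bar> \<le> \<bar>b\<bar> * (M * \<bar>u\<bar>)" for x y A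
    using assms(2,3) unfolding abs_mult flux_growth_def by (intro mult_left_mono) auto
  then show ?thesis
    using flux_variation_position[of "g k" t 0 u "M * \<bar>u\<bar>" b x y A A'] assms
    by (auto simp: flux_regular_def flux_growth_def)
qed

text \<open>Read off from the Lipschitz estimate between the densities \<open>1\<close> and
  \<open>0\<close>, which bounds an absolute value by this number.\<close>

lemma Linf_norm_D_rho_nonneg:
  assumes "flux_regular f"
  shows "0 \<le> real_of_ereal (Linf_norm flux_dom (D_rho (f k)))"
  using flux_lipschitz_density[of "f k" 0 _ _ 1 _ 0] assms
  by (force simp: flux_regular_def intro: order_trans[OF abs_ge_zero])

theorem theorem2:
  fixes f g :: "'n::finite \<Rightarrow> ('m::finite) args \<Rightarrow> real"
    and \<eta> \<nu> :: "'m \<Rightarrow> 'n \<Rightarrow> real \<times> real \<Rightarrow> real"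
    and \<rho>\<^sub>0 :: "'n \<Rightarrow> real \<times> real \<Rightarrow> real"
    and M :: real
  assumes "initial_datum \<rho>\<^sub>0"
    and "flux_regular f" and "flux_regular g"
    and "M > 0" and "flux_growth M f g"
    and "kernel_regular \<eta>" and "kernel_regular \<nu>"
  shows "\<exists>C\<ge>0. \<forall>\<theta> \<alpha> \<beta> dx dy dt :: real.
     0 < dx \<longrightarrow> 0 < dy \<longrightarrow> 0 < dt \<longrightarrow>
     \<theta> \<in> {0..1} \<longrightarrow>
     \<alpha> \<in> {0<..<1 / (3 * (1 + \<theta>))} \<longrightarrow> \<beta> \<in> {0<..<1 / (3 * (1 + \<theta>))} \<longrightarrow>
     (\<forall>k. 2 * dt / dx \<le> Min {1, 4 - 6 * (2 * \<alpha>) * (1 + \<theta>), 6 * (2 * \<alpha>)} /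
            (6 * (1 + \<theta>) * real_of_ereal (Linf_norm flux_dom (D_rho (f k))) + 1)) \<longrightarrow>
     (\<forall>k. 2 * dt / dy \<le> Min {1, 4 - 6 * (2 * \<beta>) * (1 + \<theta>), 6 * (2 * \<beta>)} /
            (6 * (1 + \<theta>) * real_of_ereal (Linf_norm flux_dom (D_rho (g k))) + 1)) \<longrightarrow>
     dx \<le> 1 / (3 * M) \<longrightarrow> dy \<le> 1 / (3 * M) \<longrightarrow>
     (\<forall>t\<ge>0. sup_norm (\<lambda>k. approx_sol f g \<eta> \<nu> \<theta> \<alpha> \<beta> dx dy dt \<rho>\<^sub>0 k t)
              \<le> sup_norm (\<lambda>k. approx_sol f g \<eta> \<nu> \<theta> \<alpha> \<beta> dx dy dt \<rho>\<^sub>0 k 0)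
                * ereal (exp (C * t)))"
proof -
  note f_reg = assms(2) and g_reg = assms(3) and growth_bounds = assms(5)
  define Lf where "Lf k = real_of_ereal (Linf_norm flux_dom (D_rho (f k)))" for k
  define Lg where "Lg k = real_of_ereal (Linf_norm flux_dom (D_rho (g k)))" for k
  obtain B where B: "\<And>q k z. \<bar>\<eta> q k z\<bar> \<le> B" "\<And>q k z. \<bar>\<nu> q k z\<bar> \<le> B"
    "\<And>q k x x' y. \<bar>\<eta> q k (x, y) - \<eta> q k (x', y)\<bar> \<le> B * \<bar>x - x'\<bar>"
    "\<And>q k x y y'. \<bar>\<nu> q k (x, y) - \<nu> q k (x, y')\<bar> \<le> B * \<bar>y - y'\<bar>"
    using kernels_bounded_lipschitz[OF assms(6,7)] by blast
  have "0 \<le> B" using order_trans[OF abs_ge_zero B(1)] .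
  have \<rho>: "integrable lebesgue (\<rho>\<^sub>0 k)" "AE z in lebesgue. 0 \<le> \<rho>\<^sub>0 k z" for k
    using assms(1) by (auto simp: initial_datum_def)
  define W where "W = (\<Sum>k\<in>UNIV. LINT z|lebesgue. \<rho>\<^sub>0 k z)"
  have "0 \<le> W" unfolding W_def using \<rho>(2) by (intro sum_nonneg integral_nonneg_AE)
  \<comment> \<open>This is \<open>2 * growth W\<close> written out: \<open>C\<close> must be fixed
    before the mesh, while \<open>growth\<close> belongs to a locale that fixes the mesh.\<close>
  define C where "C = 2 * (2 * M * (1 + real CARD('m) * (B * W)))"
  have "0 \<le> C" using \<open>0 \<le> B\<close> \<open>0 \<le> W\<close> \<open>M > 0\<close> by (simp add: C_def)
  show ?thesis
  proof (intro exI[of _ C] conjI allI impI)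
    fix \<theta> \<alpha> \<beta> dx dy dt t :: real
    assume mesh: "0 < dx" "0 < dy" "0 < dt" and \<theta>: "\<theta> \<in> {0..1}" and "0 \<le> t"
      and cfl_f: "\<forall>k. 2 * dt / dx \<le> Min {1, 4 - 6 * (2 * \<alpha>) * (1 + \<theta>), 6 * (2 * \<alpha>)} /
            (6 * (1 + \<theta>) * real_of_ereal (Linf_norm flux_dom (D_rho (f k))) + 1)"
      and cfl_g: "\<forall>k. 2 * dt / dy \<le> Min {1, 4 - 6 * (2 * \<beta>) * (1 + \<theta>), 6 * (2 * \<beta>)} /
            (6 * (1 + \<theta>) * real_of_ereal (Linf_norm flux_dom (D_rho (g k))) + 1)"
    interpret scheme_setting f g \<eta> \<nu> \<theta> \<alpha> \<beta> dx dy dt M B Lf Lg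
    proof unfold_locales
      fix k and t x y u v a b :: real and A A' :: "real ^ 'm"
      show "dt / dx * Lf k \<le> \<alpha>" "(1 + \<theta>) * (\<alpha> + dt / dx * Lf k) \<le> 1 / 3"
        using cfl_consequences[OF cfl_f[rule_format, of k] Linf_norm_D_rho_nonneg[OF f_reg]] \<theta> mesh
        by (auto simp: Lf_def)
      show "dt / dy * Lg k \<le> \<beta>" "(1 + \<theta>) * (\<beta> + dt / dy * Lg k) \<le> 1 / 3"
        using cfl_consequences[OF cfl_g[rule_format, of k] Linf_norm_D_rho_nonneg[OF g_reg]] \<theta> mesh
        by (auto simp: Lg_def)
      assume t: "0 \<le> t"
      show "f k (t, x, y, 0, A) = 0" "g k (t, x, y, 0, A) = 0"
        using f_reg g_reg t by (auto simp: flux_regular_def)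
      show "\<bar>f k (t, x, y, u, A) - f k (t, x, y, v, A)\<bar> \<le> Lf k * \<bar>u - v\<bar>"
        "\<bar>g k (t, x, y, u, A) - g k (t, x, y, v, A)\<bar> \<le> Lg k * \<bar>u - v\<bar>"
        unfolding Lf_def Lg_def
        by (rule flux_lipschitz_density; use f_reg g_reg t in \<open>simp add: flux_regular_def\<close>)+
      show "\<bar>f k (t, x + a, y, u, A) - f k (t, x, y, u, A')\<bar> \<le> M * \<bar>u\<bar> * (\<bar>a\<bar> + (\<Sum>q\<in>UNIV. \<bar>A $ q - A' $ q\<bar>))"
        by (rule flux_x_variation[OF f_reg growth_bounds t])
      show "\<bar>g k (t, x, y + b, u, A) - g k (t, x, y, u, A')\<bar> \<le> M * \<bar>u\<bar> * (\<bar>b\<bar> + (\<Sum>q\<in>UNIV. \<bar>A $ q - A' $ q\<bar>))"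
        by (rule flux_y_variation[OF g_reg growth_bounds t])
    qed (use B mesh \<theta> \<open>M > 0\<close> in auto)
    note avg = cell_averages_mass[OF mesh(1,2) \<rho>]
    define m where "m k = (\<Sum>\<^sub>\<infinity>(i, j). cell_averages dx dy \<rho>\<^sub>0 k i j)" for k
    have mass: "has_mass (cell_averages dx dy \<rho>\<^sub>0) m"
      unfolding has_mass_def m_def by (intro allI conjI avg(1) has_sum_infsum avg(2))
    have W: "dx * dy * sum m UNIV \<le> W"
      unfolding W_def m_def sum_distrib_left by (intro sum_mono avg(3))
    define s0 where "s0 = sup_norm (\<lambda>k. approx_sol f g \<eta> \<nu> \<theta> \<alpha> \<beta> dx dy dt \<rho>\<^sub>0 k 0)"
    have initial: "\<bar>cell_averages dx dy \<rho>\<^sub>0 k i j\<bar> \<le> S" if "s0 \<le> ereal S" for S k i j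
      using that abs_le_Linf_norm_grid_function[OF mesh(1,2), of "cell_averages dx dy \<rho>\<^sub>0 k"]
      by (simp add: s0_def sup_norm_le_iff approx_sol_def)
    \<comment> \<open>The norms are extended reals. If \<open>s0\<close> is \<infinity> the bound is
      trivial; if it were minus infinity, \<open>initial\<close> would give a cell average of
      modulus at most \<open>-1\<close>.\<close>
    have "sup_norm (\<lambda>k. approx_sol f g \<eta> \<nu> \<theta> \<alpha> \<beta> dx dy dt \<rho>\<^sub>0 k t) \<le> s0 * ereal (exp (C * t))"
    proof (cases s0)
      case (real S)
      define n where "n = nat \<lfloor>t / dt\<rfloor>"
      have "0 \<le> S" using initial[of S undefined 0 0] real by simp
      \<comment> \<open>At time \<open>t\<close> the solution is that of level \<open>n\<close>,
        reached at a time not after \<open>t\<close>, so the bound at that level carries over by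
        monotonicity.\<close>
      have "real n \<le> t / dt" using mesh \<open>0 \<le> t\<close> unfolding n_def by (intro of_nat_floor) auto
      then have "real n * dt \<le> t" using mesh by (simp add: pos_le_divide_eq)
      then have "exp (C * (real n * dt)) \<le> exp (C * t)" using \<open>0 \<le> C\<close> by (simp add: mult_left_mono)
      then have le: "S * exp (C * (real n * dt)) \<le> S * exp (C * t)" using \<open>0 \<le> S\<close> by (rule mult_left_mono)
      have "2 * growth W = C" by (simp add: growth_def C_def)
      have "\<bar>solution \<rho>\<^sub>0 n k i j\<bar> \<le> S * exp (C * t)" for k i j
      proof -
        have "s0 \<le> ereal S" using real by simp
        from abs_solution_le[OF mass W \<open>0 \<le> W\<close> initial[OF this], of n]
        have "\<bar>solution \<rho>\<^sub>0 n k i j\<bar> \<le> S * exp (2 * growth W * (real n * dt))" by blast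
        with le \<open>2 * growth W = C\<close> show ?thesis by simp
      qed
      then show ?thesis
        unfolding sup_norm_le_iff approx_sol_def n_def[symmetric] real
        by (simp add: Linf_norm_grid_function_le)
    next
      case PInf
      then show ?thesis by simp
    next
      case MInf
      then show ?thesis using initial[of "-1" undefined 0 0] by simp
    qed
    then show "sup_norm (\<lambda>k. approx_sol f g \<eta> \<nu> \<theta> \<alpha> \<beta> dx dy dt \<rho>\<^sub>0 k t)
        \<le> sup_norm (\<lambda>k. approx_sol f g \<eta> \<nu> \<theta> \<alpha> \<beta> dx dy dt \<rho>\<^sub>0 k 0) * ereal (exp (C * t))"
      unfolding s0_def .
  qed (fact \<open>0 \<le> C\<close>)
qed

end
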